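(* If Conditions 1 and 2 of the context hold, then $$\pi_k=\lim_{n\to\infty}\frac{\alpha_n^*U_{n,k}^*}{\alpha_n^*u_n^*},\qquad k\in\mathbb{Z}_+,$$ or equivalently, $$\pi_k=\lim_{n\to\infty}\frac{\alpha_n^*U_n^*U_{n-1}U_{n-2}\cdots U_k}{\alpha_n^*\sum_{\ell=0}^nU_n^*U_{n-1}U_{n-2}\cdots U_\ell\,e},\qquad k\in\mathbb{Z}_+,$$ where $U_k=Q_{k+1,k}U_k^*$ for $k\in\mathbb{Z}_+$.
   Context: Notation: $\mathbb{N}=\{1,2,\dots\}$, $\mathbb{Z}_+=\{0,1,2,\dots\}$, $\mathbb{Z}_n=\{0,1,\dots,n\}$. For each $k\in\mathbb{Z}_+$ let $M_k\in\mathbb{N}$, $\mathbb{M}_k=\{1,\dots,M_k\}$, $\mathbb{L}_k=\{k\}\times\mathbb{M}_k$, $\mathbb{S}=\bigcup_{k\ge0}\mathbb{L}_k$, $\mathbb{S}_n=\bigcup_{k=0}^n\mathbb{L}_k$. $e$ is the column vector of ones of appropriate size. In the product $U_{n-1}U_{n-2}\cdots U_\ell$, the case $\ell=n$ is the empty product $I$. Standing assumptions: $Q=(q(k,i;\ell,j))$ is the stable, conservative ($Qe=0$) generator of a regular-jump (non-explosive) continuous-time Markov chain on $\mathbb{S}$; it is ergodic (irreducible and positive recurrent) and upper block-Hessenberg: writing $Q_{k,\ell}$ for the $\mathbb{L}_k\times\mathbb{L}_\ell$ block, $Q_{k,\ell}=O$ whenever $\ell<k-1$. $\pi=(\pi_0,\pi_1,\dots)$,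 with $\pi_k$ indexed by $\mathbb{M}_k$, is its unique stationary distribution (row) vector: $\pi Q=0$, $\pi e=1$, $\pi>0$. Truncation: ${}_{(n)}Q$ is the restriction of $Q$ to $\mathbb{S}_n\times\mathbb{S}_n$; the inverse $(-{}_{(n)}Q)^{-1}$ exists, and its $\mathbb{L}_k\times\mathbb{L}_\ell$ block is denoted ${}_{(n)}X_{k,\ell}$. Matrices: $U_n^*={}_{(n)}X_{n,n}$; $U_{n,k}=Q_{n,n-1}\,{}_{(n-1)}X_{n-1,k}$ for $0\le k\le n-1$ and $U_{n,n}=I$; $U_{n,k}^*=U_n^*U_{n,k}$ for $k\in\mathbb{Z}_n$; $u_n^*=(u_n^*(j))_{j\in\mathbb{M}_n}=\sum_{\ell=0}^nU_{n,\ell}^*e$ (one has $u_n^*>0$). Condition 1: $Q$ is irreducible, and there exist a constant $b\in(0,\infty)$, a finite set $\mathbb{C}\subset\mathbb{S}$ and a positive column vector $v=(v(k,i))_{(k,i)\in\mathbb{S}}$ with $\inf_{(k,i)\in\mathbb{S}}v(k,i)>0$ and $Qv\le -e+b\,1_{\mathbb{C}}$, where $1_{\mathbb{C}}$ is the column vector with entries $1$ on $\mathbb{C}$ and $0$ on $\mathbb{S}\setminus\mathbb{C}$. Write $v_n=(v(n,i))_{i\in\mathbb{M}_n}$. Condition 2 (for the same $v$): $\sum_{n=0}^\infty\pi_n\Delta_nv_n<\infty$, where $\Delta_n$ is the $M_n\times M_n$ diagonal matrix with $\Delta_n(i,i)=|q(n,i;n,i)|$. Optimal augmentation: $y_n=(y_n(j))_{j\in\mathbb{M}_n}=v_n+\sum_{k=0}^nU_{n,k}^*\sum_{\ell=n+1}^\infty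 Q_{k,\ell}v_\ell>0$; $j_n^*\in\operatorname{arg\,min}_{j\in\mathbb{M}_n}y_n(j)/u_n^*(j)$; $\alpha_n^*$ is the probability row vector on $\mathbb{M}_n$ with unit mass at $j_n^*$. *)

theory Defs
  imports "HOL-Probability.Probability"
begin

section \<open>State space and finite matrices\<close>

type_synonym state = "nat \<times> nat"

definition level :: "(nat \<Rightarrow> nat) \<Rightarrow> nat \<Rightarrow> nat set" where
  "level M k = {1..M k}"

definition states :: "(nat \<Rightarrow> nat) \<Rightarrow> state set" where
  "states M = Sigma UNIV (level M)"

definition states_upto :: "(nat \<Rightarrow> nat) \<Rightarrow> nat \<Rightarrow> state set" where
  "states_upto M n = Sigma {..n} (level M)"

text \<open>
  Block sizes vary with the level, so a block is a function \<open>nat \<Rightarrow> nat \<Rightarrow> real\<close> whose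
  entries are only meaningful for indices in the corresponding sets \<open>level M k\<close>; the inner
  index set of a product is an explicit argument.
\<close>

type_synonym block = "nat \<Rightarrow> nat \<Rightarrow> real"

definition block_of :: "(state \<Rightarrow> state \<Rightarrow> real) \<Rightarrow> nat \<Rightarrow> nat \<Rightarrow> block" where
  "block_of A k l = (\<lambda>i j. A (k, i) (l, j))"

definition id_block :: block where
  "id_block = (\<lambda>i j. of_bool (i = j))"

definition block_mult :: "nat set \<Rightarrow> block \<Rightarrow> block \<Rightarrow> block" where
  "block_mult I A B = (\<lambda>i j. \<Sum>h\<in>I. A i h * B h j)"

definition block_vec :: "nat set \<Rightarrow> block \<Rightarrow> (nat \<Rightarrow> real) \<Rightarrow> (nat \<Rightarrow> real)" where
  "block_vec I A x = (\<lambda>i. \<Sum>h\<in>I. A i h * x h)"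

definition vec_block :: "nat set \<Rightarrow> (nat \<Rightarrow> real) \<Rightarrow> block \<Rightarrow> (nat \<Rightarrow> real)" where
  "vec_block I a A = (\<lambda>j. \<Sum>h\<in>I. a h * A h j)"

definition inner_on :: "nat set \<Rightarrow> (nat \<Rightarrow> real) \<Rightarrow> (nat \<Rightarrow> real) \<Rightarrow> real" where
  "inner_on I a x = (\<Sum>h\<in>I. a h * x h)"

text \<open>
  The two-sided inverse of the finite matrix \<open>(A i j)\<close> with \<open>i, j \<in> I\<close>. Requiring zero
  entries outside \<open>I \<times> I\<close> makes it unique as a function on the whole type.
\<close>

definition inverse_on :: "'a set \<Rightarrow> ('a \<Rightarrow> 'a \<Rightarrow> real) \<Rightarrow> 'a \<Rightarrow> 'a \<Rightarrow> real" where
  "inverse_on I A = (THE X.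
     (\<forall>i j. i \<notin> I \<or> j \<notin> I \<longrightarrow> X i j = 0) \<and>
     (\<forall>i\<in>I. \<forall>j\<in>I. (\<Sum>h\<in>I. A i h * X h j) = of_bool (i = j)) \<and>
     (\<forall>i\<in>I. \<forall>j\<in>I. (\<Sum>h\<in>I. X i h * A h j) = of_bool (i = j)))"


section \<open>Generators and regular-jump Markov chains\<close>

text \<open>Stability, i.e. finiteness of the diagonal, is implicit in the entries being real.\<close>

definition conservative_generator :: "'a set \<Rightarrow> ('a \<Rightarrow> 'a \<Rightarrow> real) \<Rightarrow> bool" where
  "conservative_generator S q \<longleftrightarrow>
     (\<forall>x\<in>S. \<forall>y\<in>S. x \<noteq> y \<longrightarrow> 0 \<le> q x y) \<and>
     (\<forall>x\<in>S. (q x has_sum 0) S)"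

definition irreducible_generator :: "'a set \<Rightarrow> ('a \<Rightarrow> 'a \<Rightarrow> real) \<Rightarrow> bool" where
  "irreducible_generator S q \<longleftrightarrow>
     (\<forall>x\<in>S. \<forall>y\<in>S. (x, y) \<in> {(a, b). a \<in> S \<and> b \<in> S \<and> a \<noteq> b \<and> 0 < q a b}\<^sup>*)"

definition upper_block_Hessenberg :: "(nat \<Rightarrow> nat) \<Rightarrow> (state \<Rightarrow> state \<Rightarrow> real) \<Rightarrow> bool" where
  "upper_block_Hessenberg M q \<longleftrightarrow>
     (\<forall>k l. l + 1 < k \<longrightarrow> (\<forall>i\<in>level M k. \<forall>j\<in>level M l. block_of q k l i j = 0))"

text \<open>
  A right-continuous step function on \<open>[0, \<infinity>)\<close> (values carry the discrete topology) with
  finitely many jumps in every bounded interval. Given right-continuity, the positive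
  discontinuities are exactly the failures of left-continuity.
\<close>

definition regular_jump_path :: "(real \<Rightarrow> 'a) \<Rightarrow> bool" where
  "regular_jump_path f \<longleftrightarrow>
     (\<forall>t\<ge>0. \<forall>\<^sub>F s in at_right t. f s = f t) \<and>
     (\<forall>T. finite {t \<in> {0<..T}. \<not> (\<forall>\<^sub>F s in at_left t. f s = f t)})"

text \<open>
  \<open>P x\<close> is the law under which the chain \<open>X\<close> starts in \<open>x\<close>; only times \<open>t \<ge> 0\<close> matter. The
  fourth clause is the time-homogeneous Markov property in terms of finite-dimensional
  distributions, the last one says that \<open>q\<close> is the derivative at \<open>0\<close> of the transition function.
\<close>

definition regular_jump_Markov_chain ::
    "'a set \<Rightarrow> ('a \<Rightarrow> 'a \<Rightarrow> real) \<Rightarrow> ('a \<Rightarrow> 'w measure) \<Rightarrow> (real \<Rightarrow> 'w \<Rightarrow> 'a) \<Rightarrow> bool" where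
  "regular_jump_Markov_chain S q P X \<longleftrightarrow>
     (\<forall>x\<in>S. prob_space (P x) \<and> (\<forall>t\<ge>0. X t \<in> P x \<rightarrow>\<^sub>M count_space S)) \<and>
     (\<forall>x\<in>S. AE w in P x. X 0 w = x) \<and>
     (\<forall>x\<in>S. AE w in P x. regular_jump_path (\<lambda>t. X t w)) \<and>
     (\<forall>x\<in>S. \<forall>(n::nat) t z. 0 \<le> t 0 \<and> (\<forall>m\<le>n. t m \<le> t (Suc m)) \<and> (\<forall>m\<le>Suc n. z m \<in> S) \<longrightarrow>
        measure (P x) {w \<in> space (P x). \<forall>m\<le>Suc n. X (t m) w = z m} =
        measure (P x) {w \<in> space (P x). \<forall>m\<le>n. X (t m) w = z m} *
        measure (P (z n)) {w \<in> space (P (z n)). X (t (Suc n) - t n) w = z (Suc n)}) \<and>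
     (\<forall>x\<in>S. \<forall>y\<in>S.
        ((\<lambda>t. (measure (P x) {w \<in> space (P x). X t w = y} - of_bool (x = y)) / t)
           \<longlongrightarrow> q x y) (at_right 0))"

text \<open>First time the path is in \<open>x\<close> after having been away from \<open>x\<close>; infinite if there is none.\<close>

definition return_time :: "(real \<Rightarrow> 'a) \<Rightarrow> 'a \<Rightarrow> ennreal" where
  "return_time f x = (INF t\<in>{t. f t = x \<and> (\<exists>s. 0 \<le> s \<and> s < t \<and> f s \<noteq> x)}. ennreal t)"

definition positive_recurrent ::
    "'a set \<Rightarrow> ('a \<Rightarrow> 'w measure) \<Rightarrow> (real \<Rightarrow> 'w \<Rightarrow> 'a) \<Rightarrow> bool" where
  "positive_recurrent S P X \<longleftrightarrow>
     (\<forall>x\<in>S. (\<integral>\<^sup>+w. return_time (\<lambda>t. X t w) x \<partial>P x) < \<infinity>)"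

definition ergodic_chain ::
    "'a set \<Rightarrow> ('a \<Rightarrow> 'a \<Rightarrow> real) \<Rightarrow> ('a \<Rightarrow> 'w measure) \<Rightarrow> (real \<Rightarrow> 'w \<Rightarrow> 'a) \<Rightarrow> bool" where
  "ergodic_chain S q P X \<longleftrightarrow> irreducible_generator S q \<and> positive_recurrent S P X"

definition stationary_distribution :: "'a set \<Rightarrow> ('a \<Rightarrow> 'a \<Rightarrow> real) \<Rightarrow> ('a \<Rightarrow> real) \<Rightarrow> bool" where
  "stationary_distribution S q p \<longleftrightarrow>
     (\<forall>x\<in>S. 0 < p x) \<and> (p has_sum 1) S \<and> (\<forall>y\<in>S. ((\<lambda>x. p x * q x y) has_sum 0) S)"


section \<open>Drift conditions\<close>

text \<open>
  Summability of the rows of \<open>Qv\<close> is part of the drift inequality and has to be spelled out,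
  because \<open>infsum\<close> is zero for families that are not summable.
\<close>

definition condition1 ::
    "(nat \<Rightarrow> nat) \<Rightarrow> (state \<Rightarrow> state \<Rightarrow> real) \<Rightarrow> (state \<Rightarrow> real) \<Rightarrow> bool" where
  "condition1 M q v \<longleftrightarrow>
     irreducible_generator (states M) q \<and>
     (\<forall>x\<in>states M. 0 < v x) \<and> 0 < (INF x\<in>states M. v x) \<and>
     (\<exists>b>0. \<exists>C. finite C \<and> C \<subseteq> states M \<and>
        (\<forall>x\<in>states M. (\<lambda>y. q x y * v y) summable_on states M \<and>
           (\<Sum>\<^sub>\<infinity>y\<in>states M. q x y * v y) \<le> - 1 + b * indicator C x))"

definition condition2 ::
    "(nat \<Rightarrow> nat) \<Rightarrow> (state \<Rightarrow> state \<Rightarrow> real) \<Rightarrow> (state \<Rightarrow> real) \<Rightarrow> (state \<Rightarrow> real) \<Rightarrow> bool" where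
  "condition2 M q p v \<longleftrightarrow>
     summable (\<lambda>n. \<Sum>i\<in>level M n. p (n, i) * \<bar>q (n, i) (n, i)\<bar> * v (n, i))"


section \<open>Truncations and the associated matrices\<close>

definition X_trunc :: "(nat \<Rightarrow> nat) \<Rightarrow> (state \<Rightarrow> state \<Rightarrow> real) \<Rightarrow> nat \<Rightarrow> nat \<Rightarrow> nat \<Rightarrow> block" where
  "X_trunc M q n k l = block_of (inverse_on (states_upto M n) (\<lambda>x y. - q x y)) k l"

definition U_star :: "(nat \<Rightarrow> nat) \<Rightarrow> (state \<Rightarrow> state \<Rightarrow> real) \<Rightarrow> nat \<Rightarrow> block" where
  "U_star M q n = X_trunc M q n n n"

text \<open>\<open>U_{n,k}\<close> and \<open>U^*_{n,k}\<close>; only the values with \<open>k \<le> n\<close> are meaningful.\<close>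

definition U2 :: "(nat \<Rightarrow> nat) \<Rightarrow> (state \<Rightarrow> state \<Rightarrow> real) \<Rightarrow> nat \<Rightarrow> nat \<Rightarrow> block" where
  "U2 M q n k = (if k = n then id_block
     else block_mult (level M (n - 1)) (block_of q n (n - 1)) (X_trunc M q (n - 1) (n - 1) k))"

definition U2_star :: "(nat \<Rightarrow> nat) \<Rightarrow> (state \<Rightarrow> state \<Rightarrow> real) \<Rightarrow> nat \<Rightarrow> nat \<Rightarrow> block" where
  "U2_star M q n k = block_mult (level M n) (U_star M q n) (U2 M q n k)"

definition u_star :: "(nat \<Rightarrow> nat) \<Rightarrow> (state \<Rightarrow> state \<Rightarrow> real) \<Rightarrow> nat \<Rightarrow> nat \<Rightarrow> real" where
  "u_star M q n = (\<lambda>j. \<Sum>l\<le>n. block_vec (level M l) (U2_star M q n l) (\<lambda>_. 1) j)"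

definition y_vec ::
    "(nat \<Rightarrow> nat) \<Rightarrow> (state \<Rightarrow> state \<Rightarrow> real) \<Rightarrow> (state \<Rightarrow> real) \<Rightarrow> nat \<Rightarrow> nat \<Rightarrow> real" where
  "y_vec M q v n = (\<lambda>j. v (n, j) +
     (\<Sum>k\<le>n. block_vec (level M k) (U2_star M q n k)
        (\<lambda>i. \<Sum>\<^sub>\<infinity>l\<in>{n<..}. block_vec (level M l) (block_of q k l) (\<lambda>h. v (l, h)) i) j))"

definition unit_mass :: "nat \<Rightarrow> nat \<Rightarrow> real" where
  "unit_mass j0 = (\<lambda>j. of_bool (j = j0))"

definition U1 :: "(nat \<Rightarrow> nat) \<Rightarrow> (state \<Rightarrow> state \<Rightarrow> real) \<Rightarrow> nat \<Rightarrow> block" where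
  "U1 M q k = block_mult (level M k) (block_of q (k + 1) k) (U_star M q k)"

text \<open>\<open>U1_prod M q n l\<close> is \<open>U_{n-1} U_{n-2} \<dots> U_l\<close>, the identity for \<open>l = n\<close>; it is used for \<open>l \<le> n\<close>.\<close>

primrec U1_prod :: "(nat \<Rightarrow> nat) \<Rightarrow> (state \<Rightarrow> state \<Rightarrow> real) \<Rightarrow> nat \<Rightarrow> nat \<Rightarrow> block" where
  "U1_prod M q 0 l = id_block"
| "U1_prod M q (Suc n) l =
     (if l \<le> n then block_mult (level M n) (U1 M q n) (U1_prod M q n l) else id_block)"

end

theory Submission
  imports Defs
begin

text \<open>
  Row \<open>(n, j)\<close> of \<open>(- Q\<^sub>n)\<^bsup>-1\<^esup>\<close>, where \<open>Q\<^sub>n\<close> is the truncation of the generator to the levels up to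
  \<open>n\<close>, has total mass \<open>u\<^sub>n(j)\<close>; divided by it, the row becomes a probability vector \<open>x\<close> with
  \<open>x Q\<^sub>n = - \<delta>\<^bsub>(n,j)\<^esub> / u\<^sub>n(j)\<close>: it is stationary for the truncated chain in which every jump
  that leaves the truncation is redirected to \<open>(n, j)\<close>. By the block structure this row is also
  what the matrix products in the theorem compute (\<open>U2_star_eq\<close>, \<open>U_star_U1_prod_eq\<close>), and
  \<open>y\<^sub>n(j)\<close> is the sum of \<open>v(n, j)\<close> and of the rate, weighted with \<open>v\<close>, at which the row escapes
  from the truncation (\<open>y_vec_eq\<close>).

  Convergence at a fixed state \<open>z\<close> is tested with a solution \<open>g\<close> of Poisson's equation
  \<open>Q g = - 1 + c 1\<^sub>z\<close> with \<open>0 \<le> g \<le> K v\<close>, namely the expected hitting time of \<open>z\<close>. Pairing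
  \<open>Q g\<close> with \<open>x\<close> gives \<open>c x(z) - 1\<close>; on the other hand, since \<open>x\<close> is balanced inside the
  truncation, only the boundary terms survive, and they are bounded by \<open>K y\<^sub>n(j) / u\<^sub>n(j)\<close>
  (\<open>truncated_balance\<close>). So \<open>c x(z)\<close> tends to \<open>1\<close> as soon as the ratio tends to \<open>0\<close>.

  It does for the minimising \<open>j\<close>, because the least ratio is at most the ratio of weighted sums of
  \<open>y\<^sub>n\<close> and \<open>u\<^sub>n\<close> with common nonnegative weights. Under the stationary distribution \<open>p\<close>, let \<open>\<beta>(j)\<close> be the rate of flow from level \<open>n + 1\<close> into
  \<open>(n, j)\<close>. Upward jumps may skip levels but downward ones may not, so this is the only flow into
  the truncation from outside, and \<open>\<beta>\<close> times the rows of the inverse is \<open>p\<close> restricted to the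
  truncation (\<open>sum_inflow_inverse\<close>). The \<open>\<beta>\<close>-weighted sum of \<open>u\<^sub>n\<close> is therefore the \<open>p\<close>-mass of the
  truncation, which tends to \<open>1\<close>, while that of \<open>y\<^sub>n\<close> is bounded by a term and a
  tail of the series in Condition 2 and tends to \<open>0\<close> (\<open>stationary_cost_tendsto\<close>). The same
  boundary estimate applied to \<open>p\<close> itself yields \<open>c p(z) = 1\<close>, hence the limit of \<open>x(z)\<close> is
  \<open>p(z)\<close>.

  The function \<open>g\<close> is found without probability: Condition 1 gives drift towards a finite set,
  irreducibility turns it into drift towards the single state \<open>z\<close> (\<open>drift_toward_state\<close>), and \<open>g\<close>
  is the least nonnegative solution below the resulting supersolution
  (\<open>solution_below_supersolution\<close>). With \<open>z\<close> outside the truncation, the same two facts give the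
  nonnegative inverse of \<open>- Q\<^sub>n\<close>.
\<close>

section \<open>Solutions below a supersolution\<close>

lemma infsum_split_diagonal:
  fixes q :: "'a \<Rightarrow> 'a \<Rightarrow> real"
  assumes "x \<in> S" and "(\<lambda>y. q x y * h y) summable_on S"
  shows "(\<Sum>\<^sub>\<infinity>y\<in>S. q x y * h y) = q x x * h x + (\<Sum>\<^sub>\<infinity>y\<in>S - {x}. q x y * h y)"
proof -
  have "(\<lambda>y. q x y * h y) summable_on (S - {x})"
    using assms(2) by (rule summable_on_subset) auto
  from infsum_insert[OF this, of x] show ?thesis
    using assms(1) by (simp add: insert_absorb)
qed

lemma generator_summable_mono:
  fixes q :: "'a \<Rightarrow> 'a \<Rightarrow> real"
  assumes x: "x \<in> S" and off: "\<And>y. y \<in> S \<Longrightarrow> x \<noteq> y \<Longrightarrow> 0 \<le> q x y"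
    and f: "(\<lambda>y. q x y * f y) summable_on S"
    and h: "\<And>y. y \<in> S \<Longrightarrow> 0 \<le> h y" "\<And>y. y \<in> S \<Longrightarrow> h y \<le> f y"
  shows "(\<lambda>y. q x y * h y) summable_on S"
proof -
  have "(\<lambda>y. q x y * f y) summable_on (S - {x})"
    using f by (rule summable_on_subset) auto
  then have "(\<lambda>y. q x y * h y) summable_on (S - {x})"
    by (rule summable_on_comparison_test) (use off h in \<open>auto intro!: mult_left_mono mult_nonneg_nonneg\<close>)
  then have "(\<lambda>y. q x y * h y) summable_on insert x (S - {x})"
    by (subst summable_on_insert_iff)
  then show ?thesis using x by (simp add: insert_absorb)
qed

text \<open>
  Solving row \<open>x\<close> of \<open>Q g = - b\<close> for \<open>g x\<close> puts the equation in the form \<open>T g = g\<close> with a monotone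
  operator \<open>T\<close>, and \<open>f\<close> satisfies \<open>T f \<le> f\<close>. As in the Knaster-Tarski theorem, the pointwise
  infimum of all nonnegative \<open>h \<le> f\<close> with \<open>T h \<le> h\<close> is a fixed point. The
  lemma serves both an infinite \<open>S\<close>, where it solves Poisson's equation, and finite sets, where
  it produces the columns of an inverse matrix.
\<close>
lemma solution_below_supersolution:
  fixes q :: "'a \<Rightarrow> 'a \<Rightarrow> real"
  assumes off: "\<And>x y. x \<in> S \<Longrightarrow> y \<in> S \<Longrightarrow> x \<noteq> y \<Longrightarrow> 0 \<le> q x y"
    and diag: "\<And>x. x \<in> S \<Longrightarrow> q x x < 0"
    and f0: "\<And>x. x \<in> S \<Longrightarrow> 0 \<le> f x"
    and fs: "\<And>x. x \<in> S \<Longrightarrow> (\<lambda>y. q x y * f y) summable_on S"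
    and super: "\<And>x. x \<in> S \<Longrightarrow> (\<Sum>\<^sub>\<infinity>y\<in>S. q x y * f y) \<le> - b x"
    and b0: "\<And>x. x \<in> S \<Longrightarrow> 0 \<le> b x"
  obtains g where "\<And>x. x \<in> S \<Longrightarrow> 0 \<le> g x" "\<And>x. x \<in> S \<Longrightarrow> g x \<le> f x"
    "\<And>x. x \<in> S \<Longrightarrow> (\<Sum>\<^sub>\<infinity>y\<in>S. q x y * g y) = - b x"
proof -
  define T where "T h x = (b x + (\<Sum>\<^sub>\<infinity>y\<in>S - {x}. q x y * h y)) / (- q x x)" for h x
  define A where "A = {h. \<forall>x\<in>S. 0 \<le> h x \<and> h x \<le> f x \<and> T h x \<le> h x}"
  define g where "g x = (INF h\<in>A. h x)" for x
  have summ: "(\<lambda>y. q x y * h y) summable_on S"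
    if "x \<in> S" "\<And>y. y \<in> S \<Longrightarrow> 0 \<le> h y" "\<And>y. y \<in> S \<Longrightarrow> h y \<le> f y" for h x
    by (rule generator_summable_mono[of x S q f h]) (use off fs that in auto)
  have mono: "T h x \<le> T h' x"
    if "x \<in> S" "\<And>y. y \<in> S \<Longrightarrow> 0 \<le> h y" "\<And>y. y \<in> S \<Longrightarrow> h y \<le> h' y" "\<And>y. y \<in> S \<Longrightarrow> h' y \<le> f y" for h h' x
  proof -
    have "(\<Sum>\<^sub>\<infinity>y\<in>S - {x}. q x y * h y) \<le> (\<Sum>\<^sub>\<infinity>y\<in>S - {x}. q x y * h' y)"
    proof (rule infsum_mono)
      show "(\<lambda>y. q x y * h y) summable_on (S - {x})"
        by (rule summable_on_subset[OF summ]) (use that in \<open>auto intro: order_trans\<close>)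
      show "(\<lambda>y. q x y * h' y) summable_on (S - {x})"
        by (rule summable_on_subset[OF summ]) (use that in \<open>auto intro: order_trans\<close>)
    qed (use off that in \<open>auto intro!: mult_left_mono\<close>)
    then show ?thesis
      unfolding T_def using diag[OF that(1)] by (intro divide_right_mono) auto
  qed
  have Teq: "- q x x * T h x = b x + (\<Sum>\<^sub>\<infinity>y\<in>S - {x}. q x y * h y)" if "x \<in> S" for h x
    using diag[OF that] by (simp add: T_def)
  have fA: "f \<in> A"
  proof -
    have "T f x \<le> f x" if "x \<in> S" for x
    proof -
      have "- q x x * T f x \<le> - q x x * f x"
        using super[OF that] infsum_split_diagonal[where q = q and h = f, OF that fs[OF that]] Teq[OF that, of f]
        by linarith
      then show ?thesis using diag[OF that] by (simp add: mult_le_cancel_left)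
    qed
    then show ?thesis using f0 by (auto simp: A_def)
  qed
  have bdd: "bdd_below ((\<lambda>h. h x) ` A)" if "x \<in> S" for x
    by (rule bdd_belowI[of _ 0]) (use that in \<open>auto simp: A_def\<close>)
  have g_le: "g x \<le> h x" if "x \<in> S" "h \<in> A" for h x
    unfolding g_def by (rule cINF_lower[OF bdd]) (use that in auto)
  have g0: "0 \<le> g x" if "x \<in> S" for x
    unfolding g_def by (rule cINF_greatest) (use fA that in \<open>auto simp: A_def\<close>)
  have Tg_le: "T g x \<le> g x" if "x \<in> S" for x
    unfolding g_def[of x]
  proof (rule cINF_greatest)
    fix h assume "h \<in> A"
    then have "T g x \<le> T h x"
      by (intro mono) (use that g0 g_le in \<open>auto simp: A_def\<close>)
    also have "T h x \<le> h x" using \<open>h \<in> A\<close> that by (auto simp: A_def)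
    finally show "T g x \<le> h x" .
  qed (use fA in auto)
  have Tg0: "0 \<le> T g x" if "x \<in> S" for x
  proof -
    have "0 \<le> (\<Sum>\<^sub>\<infinity>y\<in>S - {x}. q x y * g y)"
      by (rule infsum_nonneg) (use off that g0 in auto)
    then show ?thesis unfolding T_def using b0[OF that] diag[OF that] by (simp add: divide_nonneg_neg)
  qed
  have gf: "g x \<le> f x" if "x \<in> S" for x using g_le[OF that fA] .
  have "T g \<in> A"
    unfolding A_def using Tg0 Tg_le gf by (auto intro!: mono intro: order_trans)
  then have fp: "T g x = g x" if "x \<in> S" for x
    using g_le[of x "T g"] Tg_le that by (simp add: order_antisym)
  show ?thesis
  proof (rule that[of g])
    fix x assume x: "x \<in> S"
    show "(\<Sum>\<^sub>\<infinity>y\<in>S. q x y * g y) = - b x"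
      using infsum_split_diagonal[where q = q and h = g, OF x] summ[of x g] Teq[OF x, of g] fp[OF x] x g0 gf by auto
  qed (use g0 gf in auto)
qed

section \<open>Drift towards a single state\<close>

lemma summable_on_finite_support:
  fixes a \<phi> :: "'a \<Rightarrow> real"
  assumes "finite {x. \<phi> x \<noteq> 0}"
  shows "(\<lambda>y. a y * \<phi> y) summable_on S"
  by (rule finite_nonzero_values_imp_summable_on, rule finite_subset[OF _ assms]) auto

text \<open>
  Induction along a path from \<open>c\<close> to \<open>z\<close>, walked backwards. If \<open>\<phi>\<close> is strictly subharmonic at the
  second state \<open>w\<close> of the path, adding a small multiple of the point mass at \<open>w\<close> keeps it
  subharmonic there, hurts nowhere else, and makes it strictly subharmonic at the first state,
  which jumps to \<open>w\<close>. When \<open>w = z\<close>, the point mass at \<open>z\<close> does.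
\<close>
lemma exists_potential_at:
  fixes q :: "'a \<Rightarrow> 'a \<Rightarrow> real"
  assumes off: "\<And>x y. x \<in> S \<Longrightarrow> y \<in> S \<Longrightarrow> x \<noteq> y \<Longrightarrow> 0 \<le> q x y"
    and path: "(c, z) \<in> {(a, b). a \<in> S \<and> b \<in> S \<and> a \<noteq> b \<and> 0 < q a b}\<^sup>*"
    and "c \<noteq> z"
  shows "\<exists>\<phi> :: 'a \<Rightarrow> real. finite {x. \<phi> x \<noteq> 0} \<and> (\<forall>x. 0 \<le> \<phi> x) \<and>
    (\<forall>x\<in>S - {z}. 0 \<le> (\<Sum>\<^sub>\<infinity>y\<in>S. q x y * \<phi> y)) \<and> 0 < (\<Sum>\<^sub>\<infinity>y\<in>S. q c y * \<phi> y)"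
proof -
  let ?P = "\<lambda>\<phi> :: 'a \<Rightarrow> real. finite {x. \<phi> x \<noteq> 0} \<and> (\<forall>x. 0 \<le> \<phi> x) \<and>
      (\<forall>x\<in>S - {z}. 0 \<le> (\<Sum>\<^sub>\<infinity>y\<in>S. q x y * \<phi> y))"
  have point: "(\<Sum>\<^sub>\<infinity>y\<in>S. q x y * (e * of_bool (y = w))) = e * q x w" if "w \<in> S" for x w and e :: real
  proof -
    have "(\<Sum>\<^sub>\<infinity>y\<in>S. q x y * (e * of_bool (y = w))) = (\<Sum>\<^sub>\<infinity>y\<in>{w}. q x y * (e * of_bool (y = w)))"
      by (rule infsum_cong_neutral) (use that in auto)
    then show ?thesis by simp
  qed
  have "c = z \<or> (\<exists>\<phi>. ?P \<phi> \<and> 0 < (\<Sum>\<^sub>\<infinity>y\<in>S. q c y * \<phi> y))"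
    using path
  proof (induction rule: converse_rtrancl_induct)
    case base
    show ?case by simp
  next
    case (step a w)
    then have aw: "a \<in> S" "w \<in> S" "a \<noteq> w" "0 < q a w" by auto
    show ?case
    proof (cases "w = z")
      case True
      have "?P (\<lambda>y. 1 * of_bool (y = w)) \<and> 0 < (\<Sum>\<^sub>\<infinity>y\<in>S. q a y * (1 * of_bool (y = w)))"
        unfolding point[OF aw(2)] using aw off True by auto
      then show ?thesis by (intro disjI2 exI[of _ "\<lambda>y. 1 * of_bool (y = w)"])
    next
      case False
      with step obtain \<phi> where \<phi>: "?P \<phi>" "0 < (\<Sum>\<^sub>\<infinity>y\<in>S. q w y * \<phi> y)" by auto
      define s where "s = (\<Sum>\<^sub>\<infinity>y\<in>S. q w y * \<phi> y)"
      \<comment> \<open>small enough that the loss \<open>e * \<bar>q w w\<bar>\<close> at \<open>w\<close> does not exceed the surplus \<open>s\<close>\<close>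
      define e where "e = s / (\<bar>q w w\<bar> + 1)"
      have e: "0 < e" using \<phi>(2) by (simp add: e_def s_def add_nonneg_pos)
      have es: "- (e * q w w) \<le> s"
      proof -
        have "- (e * q w w) \<le> e * \<bar>q w w\<bar>" using e by (metis abs_ge_minus_self minus_mult_right mult_le_cancel_left_pos)
        also have "\<dots> \<le> e * (\<bar>q w w\<bar> + 1)" using e by simp
        also have "\<dots> = s" by (simp add: e_def)
        finally show ?thesis .
      qed
      define \<psi> where "\<psi> y = \<phi> y + e * of_bool (y = w)" for y
      have Q: "(\<Sum>\<^sub>\<infinity>y\<in>S. q x y * \<psi> y) = (\<Sum>\<^sub>\<infinity>y\<in>S. q x y * \<phi> y) + e * q x w" for x
      proof -
        have "(\<lambda>y. q x y * \<phi> y) summable_on S"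
          using \<phi>(1) by (intro summable_on_finite_support) simp
        moreover have "(\<lambda>y. q x y * (e * of_bool (y = w))) summable_on S"
          by (rule summable_on_finite_support) simp
        ultimately show ?thesis
          by (simp only: \<psi>_def distrib_left infsum_add point[OF aw(2)])
      qed
      have "{x. \<psi> x \<noteq> 0} \<subseteq> insert w {x. \<phi> x \<noteq> 0}" by (auto simp: \<psi>_def)
      then have "finite {x. \<psi> x \<noteq> 0}" using \<phi>(1) by (meson finite_insert finite_subset)
      moreover have "0 \<le> \<psi> x" for x using \<phi> e by (auto simp: \<psi>_def)
      moreover have "0 \<le> (\<Sum>\<^sub>\<infinity>y\<in>S. q x y * \<psi> y)" if "x \<in> S - {z}" for x
      proof (cases "x = w")
        case True
        then show ?thesis using es by (simp add: Q s_def)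
      next
        case False
        then show ?thesis using \<phi> e aw off[of x w] that by (simp add: Q)
      qed
      moreover have "0 < (\<Sum>\<^sub>\<infinity>y\<in>S. q a y * \<psi> y)" if "a \<noteq> z"
        using \<phi> e aw that by (simp add: Q add_nonneg_pos)
      ultimately show ?thesis by blast
    qed
  qed
  then obtain \<phi> where "?P \<phi>" "0 < (\<Sum>\<^sub>\<infinity>y\<in>S. q c y * \<phi> y)" using \<open>c \<noteq> z\<close> by auto
  then show ?thesis by (intro exI[of _ \<phi>]) auto
qed

lemma exists_potential:
  fixes q :: "'a \<Rightarrow> 'a \<Rightarrow> real"
  assumes off: "\<And>x y. x \<in> S \<Longrightarrow> y \<in> S \<Longrightarrow> x \<noteq> y \<Longrightarrow> 0 \<le> q x y"
    and irr: "irreducible_generator S q" and "z \<in> S" and "finite C" "C \<subseteq> S"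
  shows "\<exists>\<phi> :: 'a \<Rightarrow> real. finite {x. \<phi> x \<noteq> 0} \<and> (\<forall>x. 0 \<le> \<phi> x) \<and>
    (\<forall>x\<in>S - {z}. indicator C x \<le> (\<Sum>\<^sub>\<infinity>y\<in>S. q x y * \<phi> y))"
  using \<open>finite C\<close> \<open>C \<subseteq> S\<close>
proof (induction C rule: finite_induct)
  case empty
  show ?case by (rule exI[of _ "\<lambda>_. 0"]) auto
next
  case (insert c C)
  then obtain \<phi> where \<phi>: "finite {x. \<phi> x \<noteq> 0}" "\<And>x. 0 \<le> \<phi> x"
      "\<And>x. x \<in> S - {z} \<Longrightarrow> indicator C x \<le> (\<Sum>\<^sub>\<infinity>y\<in>S. q x y * (\<phi> y :: real))" by auto
  show ?case
  proof (cases "c = z")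
    case True
    then have "indicator (insert c C) x = (indicator C x :: real)" if "x \<in> S - {z}" for x
      using that by (auto simp: indicator_def)
    then show ?thesis using \<phi> by auto
  next
    case False
    have path: "(c, z) \<in> {(a, b). a \<in> S \<and> b \<in> S \<and> a \<noteq> b \<and> 0 < q a b}\<^sup>*"
      using irr insert.prems \<open>z \<in> S\<close> unfolding irreducible_generator_def by blast
    have "\<exists>\<psi> :: 'a \<Rightarrow> real. finite {x. \<psi> x \<noteq> 0} \<and> (\<forall>x. 0 \<le> \<psi> x) \<and>
        (\<forall>x\<in>S - {z}. 0 \<le> (\<Sum>\<^sub>\<infinity>y\<in>S. q x y * \<psi> y)) \<and> 0 < (\<Sum>\<^sub>\<infinity>y\<in>S. q c y * \<psi> y)"
      by (rule exists_potential_at[OF _ path False]) (rule off)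
    then obtain \<psi> :: "'a \<Rightarrow> real" where \<psi>: "finite {x. \<psi> x \<noteq> 0}" "\<forall>x. 0 \<le> \<psi> x"
        "\<forall>x\<in>S - {z}. 0 \<le> (\<Sum>\<^sub>\<infinity>y\<in>S. q x y * \<psi> y)"
        "0 < (\<Sum>\<^sub>\<infinity>y\<in>S. q c y * \<psi> y)" by (elim exE conjE)
    define s where "s = (\<Sum>\<^sub>\<infinity>y\<in>S. q c y * \<psi> y)"
    define \<theta> where "\<theta> y = \<phi> y + (1 / s) * \<psi> y" for y
    have s: "s > 0" using \<psi>(4) by (simp add: s_def)
    have "(\<Sum>\<^sub>\<infinity>y\<in>S. q x y * \<theta> y) = (\<Sum>\<^sub>\<infinity>y\<in>S. q x y * \<phi> y + (1 / s) * (q x y * \<psi> y))" for x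
      by (simp add: \<theta>_def algebra_simps)
    then have Q: "(\<Sum>\<^sub>\<infinity>y\<in>S. q x y * \<theta> y) = (\<Sum>\<^sub>\<infinity>y\<in>S. q x y * \<phi> y) + (1 / s) * (\<Sum>\<^sub>\<infinity>y\<in>S. q x y * \<psi> y)" for x
      using summable_on_finite_support[OF \<phi>(1), of "q x" S] summable_on_finite_support[OF \<psi>(1), of "q x" S]
      by (simp only: infsum_add summable_on_cmult_right infsum_cmult_right')
    have "{x. \<theta> x \<noteq> 0} \<subseteq> {x. \<phi> x \<noteq> 0} \<union> {x. \<psi> x \<noteq> 0}" by (auto simp: \<theta>_def)
    then have "finite {x. \<theta> x \<noteq> 0}" using \<phi>(1) \<psi>(1) by (meson finite_UnI finite_subset)
    moreover have "0 \<le> \<theta> x" for x using \<phi>(2) \<psi>(2) s by (auto simp: \<theta>_def)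
    moreover have "indicator (insert c C) x \<le> (\<Sum>\<^sub>\<infinity>y\<in>S. q x y * \<theta> y)" if x: "x \<in> S - {z}" for x
    proof (cases "x = c")
      case True
      have "0 \<le> (\<Sum>\<^sub>\<infinity>y\<in>S. q x y * \<phi> y)" using \<phi>(3)[OF x] by (rule order_trans[rotated]) simp
      then show ?thesis using s True by (simp add: Q s_def[symmetric])
    next
      case False
      then have "indicator (insert c C) x = (indicator C x :: real)" by (auto simp: indicator_def)
      moreover have "0 \<le> (1 / s) * (\<Sum>\<^sub>\<infinity>y\<in>S. q x y * \<psi> y)" using \<psi>(3) x s by simp
      ultimately show ?thesis using \<phi>(3)[OF x] unfolding Q by linarith
    qed
    ultimately show ?thesis by blast
  qed
qed

text \<open>
  Subtracting from \<open>v\<close> the multiple \<open>b \<phi>\<close> of a potential that gains at least \<open>1\<close> on \<open>C\<close>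
  compensates the positive drift of \<open>v\<close> on \<open>C\<close>. The constant \<open>b B\<close>, harmless because \<open>Q\<close> is
  conservative, keeps the result above \<open>v\<close>; it is at most a multiple of \<open>v\<close> because \<open>v\<close> is
  bounded away from \<open>0\<close>.
\<close>
lemma drift_toward_state:
  fixes q :: "'a \<Rightarrow> 'a \<Rightarrow> real"
  assumes cons: "conservative_generator S q" and irr: "irreducible_generator S q" and z: "z \<in> S"
    and m: "0 < m" "\<And>x. x \<in> S \<Longrightarrow> m \<le> v x"
    and vs: "\<And>x. x \<in> S \<Longrightarrow> (\<lambda>y. q x y * v y) summable_on S"
    and drift: "\<And>x. x \<in> S \<Longrightarrow> (\<Sum>\<^sub>\<infinity>y\<in>S. q x y * v y) \<le> - 1 + b * indicator C x"
    and C: "finite C" "C \<subseteq> S" and b: "0 \<le> b"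
  obtains f K where "\<And>x. x \<in> S \<Longrightarrow> 0 < f x" "\<And>x. x \<in> S \<Longrightarrow> f x \<le> K * v x"
    "\<And>x. x \<in> S \<Longrightarrow> (\<lambda>y. q x y * f y) summable_on S"
    "\<And>x. x \<in> S - {z} \<Longrightarrow> (\<Sum>\<^sub>\<infinity>y\<in>S. q x y * f y) \<le> - 1"
proof -
  have off: "0 \<le> q x y" if "x \<in> S" "y \<in> S" "x \<noteq> y" for x y
    using cons that by (auto simp: conservative_generator_def)
  obtain \<phi> where \<phi>: "finite {x. \<phi> x \<noteq> 0}" "\<And>x. 0 \<le> \<phi> x"
    "\<And>x. x \<in> S - {z} \<Longrightarrow> indicator C x \<le> (\<Sum>\<^sub>\<infinity>y\<in>S. q x y * (\<phi> y :: real))"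
    using exists_potential[OF _ irr z C] off by auto
  define B where "B = sum \<phi> {x. \<phi> x \<noteq> 0}"
  have B: "\<phi> x \<le> B" for x
  proof (cases "\<phi> x = 0")
    case True
    then show ?thesis using \<phi>(2) by (simp add: B_def sum_nonneg)
  next
    case False
    then show ?thesis unfolding B_def using \<phi>(1,2) by (intro member_le_sum) auto
  qed
  have B0: "0 \<le> B" using B \<phi>(2) order_trans by blast
  define f where "f y = v y + (b * B + (- b) * \<phi> y)" for y
  have fh: "((\<lambda>y. q x y * f y) has_sum ((\<Sum>\<^sub>\<infinity>y\<in>S. q x y * v y) + (- b) * (\<Sum>\<^sub>\<infinity>y\<in>S. q x y * \<phi> y))) S"
    if x: "x \<in> S" for x
  proof -
    have "((\<lambda>y. b * B * q x y) has_sum (b * B * 0)) S"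
      using cons x by (intro has_sum_cmult_right) (auto simp: conservative_generator_def)
    moreover have "((\<lambda>y. - b * (q x y * \<phi> y)) has_sum (- b * (\<Sum>\<^sub>\<infinity>y\<in>S. q x y * \<phi> y))) S"
      by (intro has_sum_cmult_right has_sum_infsum summable_on_finite_support \<phi>)
    ultimately have "((\<lambda>y. q x y * v y + (b * B * q x y + - b * (q x y * \<phi> y))) has_sum
        ((\<Sum>\<^sub>\<infinity>y\<in>S. q x y * v y) + (b * B * 0 + - b * (\<Sum>\<^sub>\<infinity>y\<in>S. q x y * \<phi> y)))) S"
      by (intro has_sum_add has_sum_infsum vs x)
    then show ?thesis by (simp add: f_def algebra_simps)
  qed
  have le: "v x \<le> f x" for x
  proof -
    have "b * \<phi> x \<le> b * B" using B b by (rule mult_left_mono)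
    then show ?thesis by (simp add: f_def)
  qed
  show ?thesis
  proof (rule that[of f "1 + b * B / m"])
    show "0 < f x" if "x \<in> S" for x using le[of x] m(1) m(2)[OF that] by linarith
    show "f x \<le> (1 + b * B / m) * v x" if "x \<in> S" for x
    proof -
      have "b * B = (b * B / m) * m" using m by simp
      also have "\<dots> \<le> (b * B / m) * v x" using b B0 m that by (intro mult_left_mono) auto
      finally show ?thesis
        using mult_nonneg_nonneg[OF b \<phi>(2)[of x]] by (simp add: f_def algebra_simps)
    qed
    show "(\<lambda>y. q x y * f y) summable_on S" if "x \<in> S" for x
      using fh[OF that] by (rule has_sum_imp_summable)
    show "(\<Sum>\<^sub>\<infinity>y\<in>S. q x y * f y) \<le> - 1" if "x \<in> S - {z}" for x
    proof -
      have "b * indicator C x \<le> b * (\<Sum>\<^sub>\<infinity>y\<in>S. q x y * \<phi> y)"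
        using \<phi>(3)[OF that] b by (rule mult_left_mono)
      then show ?thesis using infsumI[OF fh[of x]] drift[of x] that by auto
    qed
  qed
qed

lemma negative_drift_imp_negative_diagonal:
  fixes q :: "'a \<Rightarrow> 'a \<Rightarrow> real"
  assumes x: "x \<in> S" and off: "\<And>y. y \<in> S \<Longrightarrow> x \<noteq> y \<Longrightarrow> 0 \<le> q x y"
    and f: "\<And>y. y \<in> S \<Longrightarrow> 0 \<le> f y" and s: "(\<lambda>y. q x y * f y) summable_on S"
    and drift: "(\<Sum>\<^sub>\<infinity>y\<in>S. q x y * f y) < 0"
  shows "q x x < 0"
proof -
  have "0 \<le> (\<Sum>\<^sub>\<infinity>y\<in>S - {x}. q x y * f y)"
    by (rule infsum_nonneg) (use off f in auto)
  then have "q x x * f x < 0"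
    using drift infsum_split_diagonal[where q = q and h = f, OF x s] by linarith
  then show ?thesis using f[OF x] by (simp add: mult_less_0_iff)
qed

text \<open>
  The minimal solution of \<open>Q g = - 1\<close> off \<open>z\<close> with \<open>g z = 0\<close> is the expected hitting time of \<open>z\<close>.
  The equation is only imposed off \<open>z\<close>; \<open>c\<close> is defined as the excess of \<open>Q g\<close> over \<open>- 1\<close> at \<open>z\<close>.
\<close>
lemma poisson_solution:
  fixes q :: "'a \<Rightarrow> 'a \<Rightarrow> real"
  assumes off: "\<And>x y. x \<in> S \<Longrightarrow> y \<in> S \<Longrightarrow> x \<noteq> y \<Longrightarrow> 0 \<le> q x y" and z: "z \<in> S"
    and f: "\<And>x. x \<in> S \<Longrightarrow> 0 \<le> f x"
    and fs: "\<And>x. x \<in> S \<Longrightarrow> (\<lambda>y. q x y * f y) summable_on S"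
    and drift: "\<And>x. x \<in> S - {z} \<Longrightarrow> (\<Sum>\<^sub>\<infinity>y\<in>S. q x y * f y) \<le> - 1"
  obtains g c where "\<And>x. x \<in> S \<Longrightarrow> 0 \<le> g x" "\<And>x. x \<in> S \<Longrightarrow> g x \<le> f x"
    "\<And>x. x \<in> S \<Longrightarrow> (\<Sum>\<^sub>\<infinity>y\<in>S. q x y * g y) = - 1 + c * of_bool (x = z)"
proof -
  let ?R = "S - {z}"
  have fsR: "(\<lambda>y. q x y * f y) summable_on ?R" if "x \<in> ?R" for x
    by (rule summable_on_subset[OF fs]) (use that in auto)
  have driftR: "(\<Sum>\<^sub>\<infinity>y\<in>?R. q x y * f y) \<le> - 1" if "x \<in> ?R" for x
  proof -
    have "(\<Sum>\<^sub>\<infinity>y\<in>?R. q x y * f y) \<le> (\<Sum>\<^sub>\<infinity>y\<in>S. q x y * f y)"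
      by (rule infsum_mono2) (use that fs fsR off f z in auto)
    then show ?thesis using drift[OF that] by linarith
  qed
  have diag: "q x x < 0" if "x \<in> ?R" for x
    by (rule negative_drift_imp_negative_diagonal[of x ?R q f])
      (use that off f fsR driftR[OF that] in auto)
  obtain h where h: "\<And>x. x \<in> ?R \<Longrightarrow> 0 \<le> h x" "\<And>x. x \<in> ?R \<Longrightarrow> h x \<le> f x"
    "\<And>x. x \<in> ?R \<Longrightarrow> (\<Sum>\<^sub>\<infinity>y\<in>?R. q x y * h y) = - 1"
    by (rule solution_below_supersolution[of ?R q f "\<lambda>_. 1"]) (use off diag f fsR driftR in auto)
  define g where "g x = (if x = z then 0 else h x)" for x
  define c where "c = 1 + (\<Sum>\<^sub>\<infinity>y\<in>S. q z y * g y)"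
  have "(\<Sum>\<^sub>\<infinity>y\<in>S. q x y * g y) = (\<Sum>\<^sub>\<infinity>y\<in>?R. q x y * h y)" for x
    by (rule infsum_cong_neutral) (auto simp: g_def)
  then have "(\<Sum>\<^sub>\<infinity>y\<in>S. q x y * g y) = - 1 + c * of_bool (x = z)" if "x \<in> S" for x
    using h(3)[of x] that by (auto simp: c_def)
  moreover have "0 \<le> g x \<and> g x \<le> f x" if "x \<in> S" for x
    using h f that by (auto simp: g_def)
  ultimately show ?thesis using that by blast
qed

section \<open>Inverses of truncated generators\<close>

text \<open>
  A minimum principle: if the minimum \<open>t\<close> of \<open>h / f\<close> is negative and attained at \<open>w\<close>, then
  comparing \<open>h\<close> with \<open>t f\<close> in row \<open>w\<close> gives \<open>0 = (Q h) w \<ge> t (Q f) w > 0\<close>. Applied to \<open>h\<close>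
  and \<open>- h\<close>, it leaves only \<open>h = 0\<close>.
\<close>
lemma M_matrix_injective:
  fixes q :: "'a \<Rightarrow> 'a \<Rightarrow> real"
  assumes I: "finite I"
    and off: "\<And>x y. x \<in> I \<Longrightarrow> y \<in> I \<Longrightarrow> x \<noteq> y \<Longrightarrow> 0 \<le> q x y"
    and f: "\<And>x. x \<in> I \<Longrightarrow> 0 < f x"
    and drift: "\<And>x. x \<in> I \<Longrightarrow> (\<Sum>y\<in>I. q x y * f y) < 0"
    and h: "\<And>x. x \<in> I \<Longrightarrow> (\<Sum>y\<in>I. q x y * h y) = 0"
    and x: "x \<in> I"
  shows "h x = (0 :: real)"
proof -
  have nonneg: "0 \<le> h x" if h: "\<And>x. x \<in> I \<Longrightarrow> (\<Sum>y\<in>I. q x y * h y) = 0" and x: "x \<in> I" for h and x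
  proof (rule ccontr)
    assume neg: "\<not> 0 \<le> h x"
    define t where "t = Min ((\<lambda>x. h x / f x) ` I)"
    have "t \<in> (\<lambda>x. h x / f x) ` I" unfolding t_def using I x by (intro Min_in) auto
    then obtain w where w: "w \<in> I" "t = h w / f w" by auto
    have tle: "t \<le> h y / f y" if "y \<in> I" for y unfolding t_def using I that by (intro Min_le) auto
    have t: "t < 0" using tle[OF x] f[OF x] neg by (meson divide_neg_pos not_le order_le_less_trans)
    have ty: "t * f y \<le> h y" if "y \<in> I" for y using tle[OF that] f[OF that] by (simp add: field_simps)
    have tw: "t * f w = h w" using w f[OF w(1)] by simp
    have "t * (\<Sum>y\<in>I. q w y * f y) = (\<Sum>y\<in>I. q w y * (t * f y))"
      by (simp add: sum_distrib_left algebra_simps)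
    also have "\<dots> \<le> (\<Sum>y\<in>I. q w y * h y)"
    proof (rule sum_mono)
      fix y assume "y \<in> I"
      then show "q w y * (t * f y) \<le> q w y * h y"
        using off[OF w(1)] ty tw by (cases "w = y") (auto intro: mult_left_mono)
    qed
    finally have "t * (\<Sum>y\<in>I. q w y * f y) \<le> 0" using h[OF w(1)] by simp
    moreover have "0 < t * (\<Sum>y\<in>I. q w y * f y)" using t drift[OF w(1)] by (rule mult_neg_neg)
    ultimately show False by linarith
  qed
  have "0 \<le> h x" "0 \<le> - h x"
    using nonneg[of h x] nonneg[of "\<lambda>x. - h x" x] h x by (auto simp: sum_negf)
  then show ?thesis by simp
qed

text \<open>
  The columns of the inverse are the minimal solutions of \<open>Q g = - 1\<^sub>y\<close> below \<open>f\<close>, which makes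
  nonnegativity automatic. That the right inverse is also a left inverse, and the only one, comes
  from injectivity.
\<close>
lemma M_matrix_inverse:
  fixes q :: "'a \<Rightarrow> 'a \<Rightarrow> real"
  assumes I: "finite I"
    and off: "\<And>x y. x \<in> I \<Longrightarrow> y \<in> I \<Longrightarrow> x \<noteq> y \<Longrightarrow> 0 \<le> q x y"
    and f: "\<And>x. x \<in> I \<Longrightarrow> 0 < f x"
    and drift: "\<And>x. x \<in> I \<Longrightarrow> (\<Sum>y\<in>I. q x y * f y) \<le> - 1"
  and X_def: "X = inverse_on I (\<lambda>x y. - q x y)"
  shows "\<And>x y. 0 \<le> X x y"
    and "\<And>x y. x \<in> I \<Longrightarrow> y \<in> I \<Longrightarrow> (\<Sum>w\<in>I. q x w * X w y) = - of_bool (x = y)"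
    and "\<And>x y. x \<in> I \<Longrightarrow> y \<in> I \<Longrightarrow> (\<Sum>w\<in>I. X x w * q w y) = - of_bool (x = y)"
proof -
  let ?A = "\<lambda>x y. - q x y"
  have drift0: "(\<Sum>y\<in>I. q x y * f y) < 0" if "x \<in> I" for x using drift[OF that] by linarith
  have diag: "q x x < 0" if "x \<in> I" for x
    by (rule negative_drift_imp_negative_diagonal[of x I q f])
      (use that off I drift0 f in \<open>auto intro: less_imp_le\<close>)
  have "\<exists>g. (\<forall>x\<in>I. 0 \<le> g x \<and> (\<Sum>w\<in>I. q x w * g w) = - of_bool (x = y))" for y
  proof -
    have super: "(\<Sum>\<^sub>\<infinity>w\<in>I. q x w * f w) \<le> - of_bool (x = y)" if "x \<in> I" for x
      using drift[OF that] I by (cases "x = y") auto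
    obtain g where "\<And>x. x \<in> I \<Longrightarrow> 0 \<le> g x" "\<And>x. x \<in> I \<Longrightarrow> g x \<le> f x"
      "\<And>x. x \<in> I \<Longrightarrow> (\<Sum>\<^sub>\<infinity>w\<in>I. q x w * g w) = - of_bool (x = y)"
      by (rule solution_below_supersolution[of I q f "\<lambda>x. of_bool (x = y)"])
        (use off diag f I super in \<open>auto intro: less_imp_le\<close>)
    then show ?thesis by (intro exI[of _ g]) (use I in auto)
  qed
  then obtain G where G: "\<And>x y. x \<in> I \<Longrightarrow> 0 \<le> G y x"
    "\<And>x y. x \<in> I \<Longrightarrow> (\<Sum>w\<in>I. q x w * G y w) = - of_bool (x = y)" by metis
  define Y where "Y x y = (if x \<in> I \<and> y \<in> I then G y x else 0)" for x y
  have Y0: "0 \<le> Y x y" for x y using G(1) by (simp add: Y_def)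
  have qY: "(\<Sum>w\<in>I. q x w * Y w y) = - of_bool (x = y)" if "x \<in> I" "y \<in> I" for x y
    using G(2)[OF that(1), of y] that by (simp add: Y_def)
  have Yq: "(\<Sum>w\<in>I. Y x w * q w y) = - of_bool (x = y)" if "x \<in> I" "y \<in> I" for x y
  proof -
    define h where "h w = (\<Sum>u\<in>I. Y w u * q u y) + of_bool (w = y)" for w
    have "h x = 0"
    proof (rule M_matrix_injective[OF I off f drift0 _ that(1)])
      fix u assume u: "u \<in> I"
      have "(\<Sum>w\<in>I. q u w * h w) = (\<Sum>w\<in>I. \<Sum>t\<in>I. q u w * (Y w t * q t y)) + (\<Sum>w\<in>I. q u w * of_bool (w = y))"
        by (simp add: h_def distrib_left sum.distrib sum_distrib_left)
      also have "(\<Sum>w\<in>I. \<Sum>t\<in>I. q u w * (Y w t * q t y)) = (\<Sum>t\<in>I. (\<Sum>w\<in>I. q u w * Y w t) * q t y)"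
        by (subst sum.swap) (simp add: sum_distrib_right mult.assoc)
      also have "\<dots> = (\<Sum>t\<in>I. - of_bool (u = t) * q t y)"
        using qY[OF u] by simp
      also have "\<dots> = (\<Sum>t\<in>I. if t = u then - q t y else 0)" by (rule sum.cong) auto
      also have "\<dots> = - q u y" using I u by simp
      also have "(\<Sum>w\<in>I. q u w * of_bool (w = y)) = (\<Sum>w\<in>I. if w = y then q u w else 0)" by (rule sum.cong) auto
      also have "\<dots> = q u y" using I that(2) by simp
      finally show "(\<Sum>w\<in>I. q u w * h w) = 0" by simp
    qed
    then show ?thesis by (simp add: h_def)
  qed
  have neg: "(\<Sum>w\<in>I. - a w * c w) = - (\<Sum>w\<in>I. a w * c w)" "(\<Sum>w\<in>I. c w * - a w) = - (\<Sum>w\<in>I. c w * a w)"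
    for a c :: "'a \<Rightarrow> real" by (simp_all add: sum_negf)
  have "X = Y"
    unfolding X_def inverse_on_def
  proof (rule the_equality)
    show "(\<forall>i j. i \<notin> I \<or> j \<notin> I \<longrightarrow> Y i j = 0) \<and>
      (\<forall>i\<in>I. \<forall>j\<in>I. (\<Sum>h\<in>I. ?A i h * Y h j) = of_bool (i = j)) \<and>
      (\<forall>i\<in>I. \<forall>j\<in>I. (\<Sum>h\<in>I. Y i h * ?A h j) = of_bool (i = j))"
    proof (intro conjI allI ballI impI)
      fix i j assume "i \<notin> I \<or> j \<notin> I"
      then show "Y i j = 0" by (auto simp: Y_def)
    next
      fix i j assume ij: "i \<in> I" "j \<in> I"
      show "(\<Sum>h\<in>I. ?A i h * Y h j) = of_bool (i = j)" unfolding neg qY[OF ij] by simp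
      show "(\<Sum>h\<in>I. Y i h * ?A h j) = of_bool (i = j)" unfolding neg Yq[OF ij] by simp
    qed
  next
    fix Z
    assume Z: "(\<forall>i j. i \<notin> I \<or> j \<notin> I \<longrightarrow> Z i j = 0) \<and>
      (\<forall>i\<in>I. \<forall>j\<in>I. (\<Sum>h\<in>I. ?A i h * Z h j) = of_bool (i = j)) \<and>
      (\<forall>i\<in>I. \<forall>j\<in>I. (\<Sum>h\<in>I. Z i h * ?A h j) = of_bool (i = j))"
    have "Z i j = Y i j" for i j
    proof (cases "i \<in> I \<and> j \<in> I")
      case True
      have "Z i j - Y i j = 0"
      proof (rule M_matrix_injective[where h = "\<lambda>i. Z i j - Y i j", OF I off f drift0])
        fix x assume x: "x \<in> I"
        have "(\<Sum>w\<in>I. q x w * Z w j) = - of_bool (x = j)"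
          using bspec[OF bspec[OF conjunct1[OF conjunct2[OF Z]] x], of j] True unfolding neg by linarith
        then show "(\<Sum>w\<in>I. q x w * (Z w j - Y w j)) = 0"
          using qY[OF x] True by (simp add: right_diff_distrib sum_subtractf)
      qed (use True in auto)
      then show ?thesis by simp
    next
      case False
      then show ?thesis using Z by (auto simp: Y_def)
    qed
    then show "Z = Y" by blast
  qed
  then show "\<And>x y. 0 \<le> X x y"
    and "\<And>x y. x \<in> I \<Longrightarrow> y \<in> I \<Longrightarrow> (\<Sum>w\<in>I. q x w * X w y) = - of_bool (x = y)"
    and "\<And>x y. x \<in> I \<Longrightarrow> y \<in> I \<Longrightarrow> (\<Sum>w\<in>I. X x w * q w y) = - of_bool (x = y)"
    using Y0 qY Yq by auto
qed

section \<open>Truncations of a block-Hessenberg generator\<close>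

lemma has_sum_sum_functions:
  fixes f :: "'i \<Rightarrow> 'a \<Rightarrow> real"
  assumes "finite I" "\<And>i. i \<in> I \<Longrightarrow> (f i has_sum s i) A"
  shows "((\<lambda>x. \<Sum>i\<in>I. f i x) has_sum (\<Sum>i\<in>I. s i)) A"
  using assms by (induction I rule: finite_induct) (auto intro: has_sum_add)

locale hessenberg_drift =
  fixes M :: "nat \<Rightarrow> nat" and q :: "state \<Rightarrow> state \<Rightarrow> real" and p v :: "state \<Rightarrow> real"
  assumes M_pos: "\<And>k. 1 \<le> M k"
    and cons: "conservative_generator (states M) q"
    and Hessenberg: "upper_block_Hessenberg M q"
    and stationary: "stationary_distribution (states M) q p"
    and cond1: "condition1 M q v"
    and cond2: "condition2 M q p v"
begin

abbreviation S :: "state set" where "S \<equiv> states M"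
abbreviation T :: "nat \<Rightarrow> state set" where "T n \<equiv> states_upto M n"

definition trunc_inv :: "nat \<Rightarrow> state \<Rightarrow> state \<Rightarrow> real" where
  "trunc_inv n = inverse_on (T n) (\<lambda>x y. - q x y)"

text \<open>The inner sum over the levels above \<open>n\<close> in the definition of \<open>y\<^sub>n\<close>; see \<open>outside_v_eq\<close>.\<close>
definition outside_v :: "nat \<Rightarrow> state \<Rightarrow> real" where
  "outside_v n x = (\<Sum>\<^sub>\<infinity>y\<in>S - T n. q x y * v y)"

text \<open>For \<open>a = (n, j)\<close>, these two are \<open>u\<^sub>n(j)\<close> and \<open>y\<^sub>n(j)\<close>; see \<open>u_star_eq\<close> and \<open>y_vec_eq\<close>.\<close>
definition row_mass :: "nat \<Rightarrow> state \<Rightarrow> real" where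
  "row_mass n a = (\<Sum>x\<in>T n. trunc_inv n a x)"

definition row_cost :: "nat \<Rightarrow> state \<Rightarrow> real" where
  "row_cost n a = v a + (\<Sum>x\<in>T n. trunc_inv n a x * outside_v n x)"

lemma finite_T [simp]: "finite (T n)"
  by (simp add: states_upto_def level_def)

lemma T_subset: "T n \<subseteq> S"
  by (auto simp: states_upto_def states_def)

lemma T_imp_S: "x \<in> T n \<Longrightarrow> x \<in> S"
  using T_subset by blast

lemma in_T_iff: "x \<in> T n \<longleftrightarrow> x \<in> S \<and> fst x \<le> n"
  by (cases x) (auto simp: states_upto_def states_def)

lemma level_in_T: "j \<in> level M k \<Longrightarrow> k \<le> n \<Longrightarrow> (k, j) \<in> T n"
  by (auto simp: states_upto_def)

lemma sum_T: "(\<Sum>x\<in>T n. F x) = (\<Sum>k\<le>n. \<Sum>i\<in>level M k. F (k, i))"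
  unfolding states_upto_def by (subst sum.Sigma) (auto simp: level_def)

lemma sum_T_top:
  assumes "\<And>x. x \<in> T n \<Longrightarrow> fst x < n \<Longrightarrow> F x = 0"
  shows "(\<Sum>x\<in>T n. F x) = (\<Sum>j\<in>level M n. F (n, j))"
proof -
  have "(\<Sum>k\<le>n. \<Sum>i\<in>level M k. F (k, i)) = (\<Sum>k\<in>{n}. \<Sum>i\<in>level M k. F (k, i))"
    by (rule sum.mono_neutral_right) (auto intro!: sum.neutral assms level_in_T)
  then show ?thesis by (simp add: sum_T)
qed

lemma filterlim_T: "filterlim T (finite_subsets_at_top S) sequentially"
unfolding filterlim_finite_subsets_at_top
proof (intro allI impI)
  fix F assume "finite F \<and> F \<subseteq> S"
  then have F: "finite F" "F \<subseteq> S" by auto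
  from F have "\<forall>x\<in>F. fst x \<le> Max (insert 0 (fst ` F))" by (auto intro!: Max_ge)
  then have "\<forall>n\<ge>Max (insert 0 (fst ` F)). finite (T n) \<and> F \<subseteq> T n \<and> T n \<subseteq> S"
    using F T_subset in_T_iff by (meson finite_T order_trans subset_iff)
  then show "\<forall>\<^sub>F n in sequentially. finite (T n) \<and> F \<subseteq> T n \<and> T n \<subseteq> S"
    unfolding eventually_sequentially by blast
qed

lemma sum_T_tendsto:
  fixes F :: "state \<Rightarrow> real"
  assumes "(F has_sum s) S"
  shows "(\<lambda>n. \<Sum>x\<in>T n. F x) \<longlonglongrightarrow> s"
  using filterlim_compose[OF assms[unfolded has_sum_def] filterlim_T] by simp

lemma q_off_nonneg: "x \<in> S \<Longrightarrow> y \<in> S \<Longrightarrow> x \<noteq> y \<Longrightarrow> 0 \<le> q x y"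
  using cons by (auto simp: conservative_generator_def)

lemma q_diag_nonpos: "x \<in> S \<Longrightarrow> q x x \<le> 0"
  using cons q_off_nonneg[of x] finite_sum_le_has_sum[where f = "q x" and A = S and B = "{x}"]
  unfolding conservative_generator_def by fastforce

lemma p_nonneg: "x \<in> S \<Longrightarrow> 0 \<le> p x"
  using stationary by (auto simp: stationary_distribution_def intro: less_imp_le)

lemma p_pos: "x \<in> S \<Longrightarrow> 0 < p x"
  and p_sum: "(p has_sum 1) S"
  and p_stat: "y \<in> S \<Longrightarrow> ((\<lambda>x. p x * q x y) has_sum 0) S"
  using stationary by (auto simp: stationary_distribution_def)

lemma v_pos: "x \<in> S \<Longrightarrow> 0 < v x"
  and v_summable: "x \<in> S \<Longrightarrow> (\<lambda>y. q x y * v y) summable_on S"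
  using cond1 unfolding condition1_def by auto

lemma drift_toward:
  assumes z: "z \<in> S"
  obtains f K where "\<And>x. x \<in> S \<Longrightarrow> 0 < f x" "\<And>x. x \<in> S \<Longrightarrow> f x \<le> K * v x"
    "\<And>x. x \<in> S \<Longrightarrow> (\<lambda>y. q x y * f y) summable_on S"
    "\<And>x. x \<in> S - {z} \<Longrightarrow> (\<Sum>\<^sub>\<infinity>y\<in>S. q x y * f y) \<le> - 1"
proof -
  obtain b C where bC: "0 < b" "finite C" "C \<subseteq> S"
    "\<And>x. x \<in> S \<Longrightarrow> (\<Sum>\<^sub>\<infinity>y\<in>S. q x y * v y) \<le> - 1 + b * indicator C x"
    using cond1 unfolding condition1_def by blast
  have irr: "irreducible_generator S q" and m: "0 < (INF x\<in>S. v x)"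
    using cond1 unfolding condition1_def by auto
  have le: "(INF x\<in>S. v x) \<le> v x" if "x \<in> S" for x
    by (rule cINF_lower) (use that v_pos in \<open>auto intro!: bdd_belowI2[of _ 0] less_imp_le\<close>)
  show ?thesis
    using drift_toward_state[OF cons irr z m le v_summable bC(4,2,3) less_imp_le[OF bC(1)]] that by blast
qed

lemma poisson:
  assumes z: "z \<in> S"
  shows "\<exists>g c K. (\<forall>x\<in>S. 0 \<le> g x \<and> g x \<le> K * v x) \<and>
    (\<forall>x\<in>S. (\<Sum>\<^sub>\<infinity>y\<in>S. q x y * g y) = - 1 + c * of_bool (x = z))"
proof -
  obtain f K where f: "\<And>x. x \<in> S \<Longrightarrow> 0 < f x" "\<And>x. x \<in> S \<Longrightarrow> f x \<le> K * v x"
    "\<And>x. x \<in> S \<Longrightarrow> (\<lambda>y. q x y * f y) summable_on S"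
    "\<And>x. x \<in> S - {z} \<Longrightarrow> (\<Sum>\<^sub>\<infinity>y\<in>S. q x y * f y) \<le> - 1"
    using drift_toward[OF z] by blast
  obtain g c where g: "\<And>x. x \<in> S \<Longrightarrow> 0 \<le> g x" "\<And>x. x \<in> S \<Longrightarrow> g x \<le> f x"
    "\<And>x. x \<in> S \<Longrightarrow> (\<Sum>\<^sub>\<infinity>y\<in>S. q x y * g y) = - 1 + c * of_bool (x = z)"
    by (rule poisson_solution[OF q_off_nonneg z _ f(3,4)]) (use f(1) in \<open>auto intro: less_imp_le\<close>)
  have "g x \<le> K * v x" if "x \<in> S" for x using g(2)[OF that] f(2)[OF that] by linarith
  then show ?thesis using g by (intro exI[of _ g] exI[of _ c] exI[of _ K]) auto
qed

text \<open>
  A drift function towards a state just above the truncation has negative drift at every state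
  inside it, also after the jumps out of the truncation, which only contribute nonnegative terms,
  are discarded.
\<close>
lemma trunc_inv_nonneg: "0 \<le> trunc_inv n x y"
  and q_trunc_inv: "x \<in> T n \<Longrightarrow> y \<in> T n \<Longrightarrow> (\<Sum>w\<in>T n. q x w * trunc_inv n w y) = - of_bool (x = y)"
  and trunc_inv_q: "x \<in> T n \<Longrightarrow> y \<in> T n \<Longrightarrow> (\<Sum>w\<in>T n. trunc_inv n x w * q w y) = - of_bool (x = y)"
proof -
  let ?z = "(Suc n, 1) :: state"
  have z: "?z \<in> S" using M_pos by (auto simp: states_def level_def)
  obtain f K where f: "\<And>x. x \<in> S \<Longrightarrow> 0 < f x" "\<And>x. x \<in> S \<Longrightarrow> f x \<le> K * v x"
    "\<And>x. x \<in> S \<Longrightarrow> (\<lambda>y. q x y * f y) summable_on S"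
    "\<And>x. x \<in> S - {?z} \<Longrightarrow> (\<Sum>\<^sub>\<infinity>y\<in>S. q x y * f y) \<le> - 1"
    using drift_toward[OF z] by blast
  have offT: "0 \<le> q x y" if "x \<in> T n" "y \<in> T n" "x \<noteq> y" for x y
    using q_off_nonneg that T_subset by blast
  have fT: "0 < f x" if "x \<in> T n" for x using f(1) that T_subset by blast
  have drift: "(\<Sum>y\<in>T n. q x y * f y) \<le> - 1" if x: "x \<in> T n" for x
  proof -
    have xS: "x \<in> S - {?z}" using x by (auto simp: in_T_iff)
    have "(\<Sum>y\<in>T n. q x y * f y) \<le> (\<Sum>\<^sub>\<infinity>y\<in>S. q x y * f y)"
    proof (rule finite_sum_le_infsum)
      show "0 \<le> q x y * f y" if "y \<in> S - T n" for y
        using q_off_nonneg[of x y] f(1)[of y] that xS x by (cases "x = y") auto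
    qed (use f(3) xS T_subset in auto)
    then show ?thesis using f(4)[OF xS] by linarith
  qed
  note inv = M_matrix_inverse[OF finite_T offT fT drift trunc_inv_def]
  show "0 \<le> trunc_inv n x y" by (rule inv(1))
  show "(\<Sum>w\<in>T n. q x w * trunc_inv n w y) = - of_bool (x = y)" if "x \<in> T n" "y \<in> T n"
    by (rule inv(2)) (use that in auto)
  show "(\<Sum>w\<in>T n. trunc_inv n x w * q w y) = - of_bool (x = y)" if "x \<in> T n" "y \<in> T n"
    by (rule inv(3)) (use that in auto)
qed

lemma outside_nonneg: "x \<in> T n \<Longrightarrow> 0 \<le> outside_v n x"
  unfolding outside_v_def
proof (rule infsum_nonneg)
  fix y assume "x \<in> T n" "y \<in> S - T n"
  then show "0 \<le> q x y * v y"
    using q_off_nonneg[of x y] v_pos[of y] T_subset by fastforce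
qed

text \<open>
  Splitting \<open>Q h\<close> into the jumps inside and out of the truncation, the flow equation for \<open>w\<close>
  collapses the inside part to \<open>- \<beta> h\<close>; the outside part and this one are both estimated by
  replacing \<open>h\<close> with \<open>K v\<close>. The vector \<open>w\<close> will be a row of the inverse, with \<open>\<beta>\<close> a point mass,
  and the stationary distribution, with \<open>\<beta>\<close> the flow into the truncation from above.
\<close>
lemma truncated_balance:
  assumes w: "\<And>x. x \<in> T n \<Longrightarrow> 0 \<le> w x" and \<beta>: "\<And>y. y \<in> T n \<Longrightarrow> 0 \<le> \<beta> y"
    and flow: "\<And>y. y \<in> T n \<Longrightarrow> (\<Sum>x\<in>T n. w x * q x y) = - \<beta> y"
    and h: "\<And>x. x \<in> S \<Longrightarrow> 0 \<le> h x" "\<And>x. x \<in> S \<Longrightarrow> h x \<le> K * v x"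
  shows "\<bar>\<Sum>x\<in>T n. w x * (\<Sum>\<^sub>\<infinity>y\<in>S. q x y * h y)\<bar>
    \<le> K * ((\<Sum>y\<in>T n. \<beta> y * v y) + (\<Sum>x\<in>T n. w x * outside_v n x))"
proof -
  define e where "e x = (\<Sum>\<^sub>\<infinity>y\<in>S - T n. q x y * h y)" for x
  have hs: "(\<lambda>y. q x y * h y) summable_on S" if "x \<in> S" for x
  proof (rule generator_summable_mono[where f = "\<lambda>y. K * v y"])
    show "(\<lambda>y. q x y * (K * v y)) summable_on S"
      using summable_on_cmult_right[OF v_summable[OF that], of K] by (simp add: algebra_simps)
  qed (use that q_off_nonneg h in auto)
  have split: "(\<Sum>\<^sub>\<infinity>y\<in>S. q x y * h y) = (\<Sum>y\<in>T n. q x y * h y) + e x" if "x \<in> T n" for x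
  proof -
    have "x \<in> S" using that T_subset by auto
    then have "(\<lambda>y. q x y * h y) summable_on (S - T n)"
      by (rule summable_on_subset[OF hs]) auto
    then have "(\<Sum>\<^sub>\<infinity>y\<in>T n \<union> (S - T n). q x y * h y) = (\<Sum>\<^sub>\<infinity>y\<in>T n. q x y * h y) + e x"
      unfolding e_def by (intro infsum_Un_disjoint) auto
    then show ?thesis using T_subset by (simp add: Un_absorb1)
  qed
  have e0: "0 \<le> e x" and eK: "e x \<le> K * outside_v n x" if x: "x \<in> T n" for x
  proof -
    have xS: "x \<in> S" using that T_subset by auto
    have qn: "0 \<le> q x y" if "y \<in> S - T n" for y using q_off_nonneg[of x y] that x xS by auto
    show "0 \<le> e x" unfolding e_def using qn h by (intro infsum_nonneg) auto
    have "e x \<le> (\<Sum>\<^sub>\<infinity>y\<in>S - T n. K * (q x y * v y))"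
      unfolding e_def
    proof (rule infsum_mono)
      show "(\<lambda>y. q x y * h y) summable_on (S - T n)"
        by (rule summable_on_subset[OF hs[OF xS]]) auto
      show "(\<lambda>y. K * (q x y * v y)) summable_on (S - T n)"
        by (intro summable_on_cmult_right summable_on_subset[OF v_summable[OF xS]]) auto
      show "q x y * h y \<le> K * (q x y * v y)" if "y \<in> S - T n" for y
        using mult_left_mono[OF h(2)[of y] qn[OF that]] that by (simp add: algebra_simps)
    qed
    then show "e x \<le> K * outside_v n x" by (simp add: outside_v_def infsum_cmult_right')
  qed
  have "(\<Sum>x\<in>T n. w x * (\<Sum>\<^sub>\<infinity>y\<in>S. q x y * h y))
      = (\<Sum>x\<in>T n. \<Sum>y\<in>T n. w x * q x y * h y) + (\<Sum>x\<in>T n. w x * e x)"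
    by (simp add: split distrib_left sum.distrib sum_distrib_left mult.assoc)
  also have "(\<Sum>x\<in>T n. \<Sum>y\<in>T n. w x * q x y * h y) = - (\<Sum>y\<in>T n. \<beta> y * h y)"
    by (subst sum.swap) (simp add: sum_distrib_right[symmetric] flow sum_negf)
  finally have eq: "(\<Sum>x\<in>T n. w x * (\<Sum>\<^sub>\<infinity>y\<in>S. q x y * h y))
      = (\<Sum>x\<in>T n. w x * e x) - (\<Sum>y\<in>T n. \<beta> y * h y)" by simp
  have "0 \<le> (\<Sum>x\<in>T n. w x * e x)" using w e0 by (intro sum_nonneg) auto
  moreover have "0 \<le> (\<Sum>y\<in>T n. \<beta> y * h y)" using \<beta> h(1) T_imp_S by (meson sum_nonneg mult_nonneg_nonneg)
  moreover have "(\<Sum>x\<in>T n. w x * e x) \<le> K * (\<Sum>x\<in>T n. w x * outside_v n x)"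
  proof -
    have "(\<Sum>x\<in>T n. w x * e x) \<le> (\<Sum>x\<in>T n. w x * (K * outside_v n x))"
      using w eK by (intro sum_mono mult_left_mono) auto
    then show ?thesis by (simp add: sum_distrib_left algebra_simps)
  qed
  moreover have "(\<Sum>y\<in>T n. \<beta> y * h y) \<le> K * (\<Sum>y\<in>T n. \<beta> y * v y)"
  proof -
    have "(\<Sum>y\<in>T n. \<beta> y * h y) \<le> (\<Sum>y\<in>T n. \<beta> y * (K * v y))"
      using \<beta> h(2) T_imp_S by (meson sum_mono mult_left_mono)
    then show ?thesis by (simp add: sum_distrib_left algebra_simps)
  qed
  ultimately show ?thesis unfolding eq by (simp add: distrib_left)
qed

lemma row_mass_pos:
  assumes a: "a \<in> T n"
  shows "0 < row_mass n a"
proof -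
  have "row_mass n a \<noteq> 0"
  proof
    assume "row_mass n a = 0"
    then have "\<forall>x\<in>T n. trunc_inv n a x = 0"
      unfolding row_mass_def using trunc_inv_nonneg by (subst (asm) sum_nonneg_eq_0_iff) auto
    then show False using trunc_inv_q[OF a a] by simp
  qed
  moreover have "0 \<le> row_mass n a" unfolding row_mass_def using trunc_inv_nonneg by (intro sum_nonneg) auto
  ultimately show ?thesis by simp
qed

lemma row_cost_nonneg: "a \<in> T n \<Longrightarrow> 0 \<le> row_cost n a"
  unfolding row_cost_def using v_pos[of a] T_subset trunc_inv_nonneg outside_nonneg
  by (intro add_nonneg_nonneg sum_nonneg mult_nonneg_nonneg) (auto intro: less_imp_le)

section \<open>Flow of the stationary distribution into the truncation\<close>

text \<open>
  By stationarity this defect of balance inside the truncation is the rate of flow from outside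
  it, the sum of \<open>p x * q x y\<close> over the states \<open>x\<close> outside \<open>T n\<close>.
\<close>
definition inflow :: "nat \<Rightarrow> state \<Rightarrow> real" where
  "inflow n y = - (\<Sum>x\<in>T n. p x * q x y)"

text \<open>
  The boundary terms of \<open>truncated_balance\<close> for \<open>p\<close>, and also the \<open>inflow\<close>-weighted sum of
  \<open>row_cost\<close> over level \<open>n\<close> (\<open>sum_inflow_row_cost\<close>).
\<close>
definition stationary_cost :: "nat \<Rightarrow> real" where
  "stationary_cost n = (\<Sum>j\<in>level M n. inflow n (n, j) * v (n, j)) + (\<Sum>x\<in>T n. p x * outside_v n x)"

lemma sum_into_le:
  assumes y: "y \<in> S" and F: "finite F" "F \<subseteq> S - {y}"
  shows "(\<Sum>x\<in>F. p x * q x y) \<le> p y * \<bar>q y y\<bar>"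
proof -
  have "(\<Sum>x\<in>insert y F. p x * q x y) \<le> 0"
  proof (rule finite_sum_le_has_sum[OF p_stat[OF y]])
    show "0 \<le> p x * q x y" if "x \<in> S - insert y F" for x
      using that y by (intro mult_nonneg_nonneg p_nonneg q_off_nonneg) auto
  qed (use F y in auto)
  then have "p y * q y y + (\<Sum>x\<in>F. p x * q x y) \<le> 0" using F by (subst (asm) sum.insert) auto
  then show ?thesis using q_diag_nonpos[OF y] by simp
qed

lemma inflow_nonneg:
  assumes y: "y \<in> T n"
  shows "0 \<le> inflow n y"
proof -
  have yS: "y \<in> S" using y T_subset by auto
  have "(\<Sum>x\<in>T n. p x * q x y) \<le> 0"
  proof (rule finite_sum_le_has_sum[OF p_stat[OF yS]])
    show "0 \<le> p x * q x y" if "x \<in> S - T n" for x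
      using that y yS by (intro mult_nonneg_nonneg p_nonneg q_off_nonneg) auto
  qed (use T_subset in auto)
  then show ?thesis by (simp add: inflow_def)
qed

lemma inflow_le:
  assumes y: "y \<in> T n"
  shows "inflow n y \<le> p y * \<bar>q y y\<bar>"
proof -
  have yS: "y \<in> S" using y T_subset by auto
  have "0 \<le> (\<Sum>x\<in>T n - {y}. p x * q x y)"
    by (intro sum_nonneg mult_nonneg_nonneg) (use yS in \<open>auto intro: T_imp_S p_nonneg q_off_nonneg simp del: split_paired_all\<close>)
  moreover have "(\<Sum>x\<in>T n. p x * q x y) = p y * q y y + (\<Sum>x\<in>T n - {y}. p x * q x y)"
    using y by (subst sum.remove[of _ y]) auto
  ultimately show ?thesis using q_diag_nonpos[OF yS] by (simp add: inflow_def)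
qed

lemma Hessenberg_zero: "x \<in> S \<Longrightarrow> y \<in> S \<Longrightarrow> fst y + 1 < fst x \<Longrightarrow> q x y = 0"
  using Hessenberg unfolding upper_block_Hessenberg_def block_of_def states_def
  by (cases x; cases y) auto

text \<open>A jump from above level \<open>n\<close> goes down by at most one level, so it lands on level \<open>n\<close> or above.\<close>
lemma inflow_below_top:
  assumes y: "y \<in> T n" "fst y < n"
  shows "inflow n y = 0"
proof -
  have yS: "y \<in> S" using y T_subset by auto
  have "((\<lambda>x. p x * q x y) has_sum 0) (T n) \<longleftrightarrow> ((\<lambda>x. p x * q x y) has_sum 0) S"
  proof (rule has_sum_cong_neutral)
    show "p x * q x y = 0" if "x \<in> S - T n" for x
      using that y yS Hessenberg_zero[of x y] by (auto simp: in_T_iff simp del: mult_eq_0_iff)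
  qed (use T_subset in auto)
  then have "((\<lambda>x. p x * q x y) has_sum 0) (T n)" using p_stat[OF yS] by simp
  then have "(\<Sum>x\<in>T n. p x * q x y) = 0" using has_sum_unique has_sum_finite[OF finite_T] by blast
  then show ?thesis by (simp add: inflow_def)
qed

text \<open>
  The flow equation \<open>p (- Q\<^sub>n) = inflow n\<close> multiplied by the inverse; only level \<open>n\<close> contributes
  because \<open>inflow n\<close> vanishes below it.
\<close>
lemma sum_inflow_inverse:
  assumes x: "x \<in> T n"
  shows "(\<Sum>j\<in>level M n. inflow n (n, j) * trunc_inv n (n, j) x) = p x"
proof -
  have "(\<Sum>j\<in>level M n. inflow n (n, j) * trunc_inv n (n, j) x) = (\<Sum>y\<in>T n. inflow n y * trunc_inv n y x)"
    by (subst sum_T_top) (auto simp: inflow_below_top)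
  also have "\<dots> = - (\<Sum>y\<in>T n. \<Sum>w\<in>T n. p w * (q w y * trunc_inv n y x))"
    by (simp add: inflow_def sum_negf sum_distrib_right mult.assoc)
  also have "\<dots> = - (\<Sum>w\<in>T n. p w * (\<Sum>y\<in>T n. q w y * trunc_inv n y x))"
    by (subst sum.swap) (simp add: sum_distrib_left)
  also have "\<dots> = - (\<Sum>w\<in>T n. p w * - of_bool (w = x))"
    using q_trunc_inv[OF _ x] by simp
  also have "\<dots> = (\<Sum>w\<in>T n. if w = x then p w else 0)"
    unfolding sum_negf[symmetric] by (rule sum.cong) auto
  also have "\<dots> = p x" using x by simp
  finally show ?thesis .
qed

lemma sum_inflow_row_mass: "(\<Sum>j\<in>level M n. inflow n (n, j) * row_mass n (n, j)) = (\<Sum>x\<in>T n. p x)"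
  unfolding row_mass_def sum_distrib_left
  by (subst sum.swap) (simp add: sum_inflow_inverse)

lemma sum_inflow_row_cost: "(\<Sum>j\<in>level M n. inflow n (n, j) * row_cost n (n, j)) = stationary_cost n"
proof -
  have "(\<Sum>j\<in>level M n. \<Sum>x\<in>T n. inflow n (n, j) * (trunc_inv n (n, j) x * outside_v n x))
    = (\<Sum>x\<in>T n. (\<Sum>j\<in>level M n. inflow n (n, j) * trunc_inv n (n, j) x) * outside_v n x)"
    by (subst sum.swap) (simp add: sum_distrib_right mult.assoc)
  then show ?thesis
    by (simp add: row_cost_def stationary_cost_def distrib_left sum.distrib sum_distrib_left sum_inflow_inverse)
qed

text \<open>
  Both parts are controlled by \<open>d y = p y * \<bar>q y y\<bar> * v y\<close>, since by stationarity the flow into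
  \<open>y\<close> from any set of other states is at most \<open>p y * \<bar>q y y\<bar>\<close>: the first part is bounded by the
  \<open>n\<close>-th term of the series in Condition 2, and the second, once it is summed over target states,
  by its tail.
\<close>
lemma stationary_cost_tendsto: "stationary_cost \<longlonglongrightarrow> 0"
proof -
  define d where "d y = p y * \<bar>q y y\<bar> * v y" for y
  have d0: "0 \<le> d y" if "y \<in> S" for y using that p_pos v_pos by (simp add: d_def less_imp_le)
  have a: "summable (\<lambda>n. \<Sum>i\<in>level M n. d (n, i))"
    using cond2 by (simp add: condition2_def d_def)
  have dS: "d summable_on S"
    unfolding states_def
  proof (rule summable_on_SigmaI)
    show "((\<lambda>y. d (x, y)) has_sum (\<Sum>i\<in>level M x. d (x, i))) (level M x)" for x
      by (rule has_sum_finite) (simp add: level_def)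
    show "(\<lambda>x. \<Sum>i\<in>level M x. d (x, i)) summable_on UNIV"
      by (rule summable_nonneg_imp_summable_on[OF a]) (auto intro!: sum_nonneg d0 simp: states_def)
  qed (auto intro!: d0 simp: states_def)
  have "(\<lambda>n. infsum d S - (\<Sum>x\<in>T n. d x)) \<longlonglongrightarrow> infsum d S - infsum d S"
    by (intro tendsto_diff tendsto_const sum_T_tendsto has_sum_infsum dS)
  then have lim: "(\<lambda>n. (\<Sum>i\<in>level M n. d (n, i)) + (infsum d S - (\<Sum>x\<in>T n. d x))) \<longlonglongrightarrow> 0"
    using tendsto_add[OF summable_LIMSEQ_zero[OF a]] by fastforce
  have lower: "0 \<le> stationary_cost n" for n
    unfolding stationary_cost_def
  proof (intro add_nonneg_nonneg sum_nonneg mult_nonneg_nonneg)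
    show "0 \<le> inflow n (n, j)" if "j \<in> level M n" for j using that by (intro inflow_nonneg level_in_T) auto
    show "0 \<le> v (n, j)" if "j \<in> level M n" for j using that v_pos[of "(n, j)"] by (auto simp: states_def)
    show "0 \<le> p x" if "x \<in> T n" for x using that by (intro p_nonneg T_imp_S)
  qed (rule outside_nonneg)
  have upper: "stationary_cost n \<le> (\<Sum>i\<in>level M n. d (n, i)) + (infsum d S - (\<Sum>x\<in>T n. d x))" for n
  proof -
    have "(\<Sum>j\<in>level M n. inflow n (n, j) * v (n, j)) \<le> (\<Sum>i\<in>level M n. d (n, i))"
      unfolding d_def
    proof (intro sum_mono mult_right_mono)
      show "inflow n (n, j) \<le> p (n, j) * \<bar>q (n, j) (n, j)\<bar>" if "j \<in> level M n" for j
        using that by (intro inflow_le level_in_T) auto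
      show "0 \<le> v (n, j)" if "j \<in> level M n" for j using that v_pos[of "(n, j)"] by (auto simp: states_def)
    qed
    moreover have "(\<Sum>x\<in>T n. p x * outside_v n x) \<le> infsum d (S - T n)"
    proof (rule has_sum_mono)
      show "((\<lambda>y. \<Sum>x\<in>T n. p x * (q x y * v y)) has_sum (\<Sum>x\<in>T n. p x * outside_v n x)) (S - T n)"
        unfolding outside_v_def
      proof (intro has_sum_sum_functions has_sum_cmult_right has_sum_infsum finite_T)
        show "(\<lambda>y. q x y * v y) summable_on (S - T n)" if "x \<in> T n" for x
          by (rule summable_on_subset[OF v_summable]) (use that T_subset in auto)
      qed
      show "(d has_sum infsum d (S - T n)) (S - T n)"
        by (intro has_sum_infsum summable_on_subset[OF dS]) auto
      show "(\<Sum>x\<in>T n. p x * (q x y * v y)) \<le> d y" if y: "y \<in> S - T n" for y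
      proof -
        have "(\<Sum>x\<in>T n. p x * q x y) * v y \<le> p y * \<bar>q y y\<bar> * v y"
          by (intro mult_right_mono sum_into_le) (use y T_subset v_pos[of y] in auto)
        then show ?thesis by (simp add: d_def sum_distrib_right mult.assoc)
      qed
    qed
    moreover have "infsum d (S - T n) = infsum d S - (\<Sum>x\<in>T n. d x)"
      using infsumI[OF has_sum_Diff[OF has_sum_infsum[OF dS] has_sum_finite[OF finite_T] T_subset]] .
    ultimately show ?thesis unfolding stationary_cost_def by linarith
  qed
  show ?thesis
    by (rule tendsto_sandwich[OF _ _ tendsto_const lim]) (auto simp: lower upper)
qed

section \<open>Convergence of the normalised rows\<close>

lemma truncated_row_tendsto:
  assumes a: "\<And>n. j n \<in> level M n"
    and arg_min: "\<And>n i. i \<in> level M n \<Longrightarrow>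
      row_cost n (n, j n) / row_mass n (n, j n) \<le> row_cost n (n, i) / row_mass n (n, i)"
    and z: "z \<in> S"
  shows "(\<lambda>n. trunc_inv n (n, j n) z / row_mass n (n, j n)) \<longlonglongrightarrow> p z"
proof -
  define r where "r n = row_cost n (n, j n) / row_mass n (n, j n)" for n
  have aT: "(n, j n) \<in> T n" for n using a by (auto intro: level_in_T)
  have mass: "0 < row_mass n (n, j n)" for n using aT by (rule row_mass_pos)
  have r0: "0 \<le> r n" for n unfolding r_def using row_cost_nonneg[OF aT] mass[THEN less_imp_le] by (rule divide_nonneg_nonneg)
  have p_lim: "(\<lambda>n. \<Sum>x\<in>T n. p x) \<longlonglongrightarrow> 1" by (rule sum_T_tendsto[OF p_sum])
  \<comment> \<open>the minimal ratio is at most the ratio of the sums with weights \<open>inflow n\<close>\<close>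
  have r_le: "r n * (\<Sum>x\<in>T n. p x) \<le> stationary_cost n" for n
  proof -
    have "(\<Sum>i\<in>level M n. inflow n (n, i) * (r n * row_mass n (n, i)))
        \<le> (\<Sum>i\<in>level M n. inflow n (n, i) * row_cost n (n, i))"
    proof (intro sum_mono mult_left_mono)
      fix i assume i: "i \<in> level M n"
      then have iT: "(n, i) \<in> T n" by (auto intro: level_in_T)
      show "0 \<le> inflow n (n, i)" using iT by (rule inflow_nonneg)
      show "r n * row_mass n (n, i) \<le> row_cost n (n, i)"
        using arg_min[OF i] row_mass_pos[OF iT] unfolding r_def[symmetric] by (simp add: pos_le_divide_eq)
    qed
    moreover have "(\<Sum>i\<in>level M n. inflow n (n, i) * (r n * row_mass n (n, i)))
        = r n * (\<Sum>i\<in>level M n. inflow n (n, i) * row_mass n (n, i))"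
      by (simp add: sum_distrib_left algebra_simps)
    ultimately show ?thesis by (simp add: sum_inflow_row_mass sum_inflow_row_cost)
  qed
  have r_lim: "r \<longlonglongrightarrow> 0"
  proof (rule tendsto_sandwich[OF _ _ tendsto_const])
    show "(\<lambda>n. stationary_cost n / (\<Sum>x\<in>T n. p x)) \<longlonglongrightarrow> 0"
      using tendsto_divide[OF stationary_cost_tendsto p_lim] by simp
    have "\<forall>\<^sub>F n in sequentially. 0 < (\<Sum>x\<in>T n. p x)"
      using p_lim by (rule order_tendstoD) simp
    then show "\<forall>\<^sub>F n in sequentially. r n \<le> stationary_cost n / (\<Sum>x\<in>T n. p x)"
      by eventually_elim (use r_le in \<open>simp add: pos_le_divide_eq\<close>)
  qed (use r0 in auto)
  obtain g c K where "\<forall>x\<in>S. 0 \<le> g x \<and> g x \<le> K * v x"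
    and "\<forall>x\<in>S. (\<Sum>\<^sub>\<infinity>y\<in>S. q x y * g y) = - 1 + c * of_bool (x = z)"
    using poisson[OF z] by (elim exE conjE)
  then have g: "\<And>x. x \<in> S \<Longrightarrow> 0 \<le> g x" "\<And>x. x \<in> S \<Longrightarrow> g x \<le> K * v x"
    and Qg: "\<And>x. x \<in> S \<Longrightarrow> (\<Sum>\<^sub>\<infinity>y\<in>S. q x y * g y) = - 1 + c * of_bool (x = z)" by auto
  \<comment> \<open>the left-hand side of \<open>truncated_balance\<close> for \<open>h = g\<close>\<close>
  have wQg: "(\<Sum>x\<in>T n. w x * (\<Sum>\<^sub>\<infinity>y\<in>S. q x y * g y)) = c * w z - (\<Sum>x\<in>T n. w x)" if zT: "z \<in> T n" for w n
  proof -
    have "(\<Sum>x\<in>T n. w x * (\<Sum>\<^sub>\<infinity>y\<in>S. q x y * g y)) = (\<Sum>x\<in>T n. (if x = z then c * w x else 0) - w x)"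
    proof (rule sum.cong)
      fix x assume "x \<in> T n"
      from Qg[OF T_imp_S[OF this]] show "w x * (\<Sum>\<^sub>\<infinity>y\<in>S. q x y * g y) = (if x = z then c * w x else 0) - w x"
        by (simp add: right_diff_distrib mult.commute)
    qed simp
    also have "\<dots> = c * w z - (\<Sum>x\<in>T n. w x)" using zT by (simp add: sum_subtractf)
    finally show ?thesis .
  qed
  have zT: "\<forall>\<^sub>F n in sequentially. z \<in> T n"
    using eventually_ge_at_top[of "fst z"] by eventually_elim (use z in_T_iff in auto)
  have row: "\<bar>c * (trunc_inv n (n, j n) z / row_mass n (n, j n)) - 1\<bar> \<le> K * r n" if n: "z \<in> T n" for n
  proof -
    let ?m = "row_mass n (n, j n)"
    have "\<bar>c * trunc_inv n (n, j n) z - ?m\<bar>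
        \<le> K * ((\<Sum>y\<in>T n. of_bool ((n, j n) = y) * v y) + (\<Sum>x\<in>T n. trunc_inv n (n, j n) x * outside_v n x))"
      unfolding row_mass_def wQg[OF n, symmetric]
      by (rule truncated_balance) (use trunc_inv_nonneg trunc_inv_q[OF aT] g in auto)
    also have "(\<Sum>y\<in>T n. of_bool ((n, j n) = y) * v y) = (\<Sum>y\<in>T n. if y = (n, j n) then v y else 0)"
      by (rule sum.cong) auto
    also have "\<dots> = v (n, j n)" using aT by simp
    finally have "\<bar>c * trunc_inv n (n, j n) z - ?m\<bar> \<le> K * row_cost n (n, j n)"
      by (simp add: row_cost_def)
    then have "\<bar>c * trunc_inv n (n, j n) z - ?m\<bar> / ?m \<le> K * row_cost n (n, j n) / ?m"
      using mass[THEN less_imp_le] by (rule divide_right_mono)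
    moreover have "\<bar>c * trunc_inv n (n, j n) z - ?m\<bar> / ?m = \<bar>(c * trunc_inv n (n, j n) z - ?m) / ?m\<bar>"
      using mass[of n] by simp
    ultimately show ?thesis using mass[of n] by (simp add: r_def diff_divide_distrib)
  qed
  have "(\<lambda>n. c * (trunc_inv n (n, j n) z / row_mass n (n, j n)) - 1) \<longlonglongrightarrow> 0"
  proof (rule Lim_null_comparison)
    show "\<forall>\<^sub>F n in sequentially. norm (c * (trunc_inv n (n, j n) z / row_mass n (n, j n)) - 1) \<le> K * r n"
      using zT by eventually_elim (use row in simp)
    show "(\<lambda>n. K * r n) \<longlonglongrightarrow> 0" using tendsto_mult_right_zero[OF r_lim] .
  qed
  from tendsto_add[OF this tendsto_const[of 1]]
  have row_lim: "(\<lambda>n. c * (trunc_inv n (n, j n) z / row_mass n (n, j n))) \<longlonglongrightarrow> 1" by simp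
  have "(\<lambda>n. c * p z - (\<Sum>x\<in>T n. p x)) \<longlonglongrightarrow> 0"
  proof (rule Lim_null_comparison)
    have "\<bar>c * p z - (\<Sum>x\<in>T n. p x)\<bar> \<le> K * stationary_cost n" if n: "z \<in> T n" for n
    proof -
      have "\<bar>c * p z - (\<Sum>x\<in>T n. p x)\<bar>
          \<le> K * ((\<Sum>y\<in>T n. inflow n y * v y) + (\<Sum>x\<in>T n. p x * outside_v n x))"
        unfolding wQg[OF n, symmetric]
        by (rule truncated_balance) (use p_nonneg T_imp_S inflow_nonneg g in \<open>auto simp: inflow_def\<close>)
      also have "(\<Sum>y\<in>T n. inflow n y * v y) = (\<Sum>i\<in>level M n. inflow n (n, i) * v (n, i))"
        by (rule sum_T_top) (simp add: inflow_below_top)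
      finally show ?thesis by (simp add: stationary_cost_def)
    qed
    then show "\<forall>\<^sub>F n in sequentially. norm (c * p z - (\<Sum>x\<in>T n. p x)) \<le> K * stationary_cost n"
      using zT by (auto elim: eventually_mono)
    show "(\<lambda>n. K * stationary_cost n) \<longlonglongrightarrow> 0" using tendsto_mult_right_zero[OF stationary_cost_tendsto] .
  qed
  moreover have "(\<lambda>n. c * p z - (\<Sum>x\<in>T n. p x)) \<longlonglongrightarrow> c * p z - 1"
    by (intro tendsto_diff tendsto_const p_lim)
  ultimately have cp: "c * p z = 1" using LIMSEQ_unique by fastforce
  then have "(\<lambda>n. p z * (c * (trunc_inv n (n, j n) z / row_mass n (n, j n)))) \<longlonglongrightarrow> p z * 1"
    by (intro tendsto_mult tendsto_const row_lim)
  moreover have "p z * (c * t) = t" for t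
  proof -
    have "p z * (c * t) = (c * p z) * t" by (simp only: mult_ac)
    then show ?thesis using cp by simp
  qed
  ultimately show ?thesis by simp
qed

section \<open>Block formulas for the last rows of the inverse\<close>

text \<open>
  Row \<open>(n + 1, j)\<close> of \<open>X Q = - I\<close>, restricted to the columns in \<open>T n\<close>, expresses
  (row restricted to \<open>T n\<close>) times \<open>- Q\<^sub>n\<close> through the last block of the row; multiplying by
  the inverse of \<open>- Q\<^sub>n\<close> solves for the restricted row. In the product with \<open>q (n + 1, h)\<close> only
  level \<open>n\<close> remains by the Hessenberg property.
\<close>
lemma trunc_inv_last_row:
  assumes j: "j \<in> level M (Suc n)" and y: "y \<in> T n"
  shows "trunc_inv (Suc n) (Suc n, j) y
    = (\<Sum>h\<in>level M (Suc n). trunc_inv (Suc n) (Suc n, j) (Suc n, h) * (\<Sum>i\<in>level M n. q (Suc n, h) (n, i) * trunc_inv n (n, i) y))"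
proof -
  let ?w = "trunc_inv (Suc n) (Suc n, j)"
  have jT: "(Suc n, j) \<in> T (Suc n)" using j by (auto intro: level_in_T)
  have flow: "(\<Sum>x\<in>T n. ?w x * q x u) + (\<Sum>h\<in>level M (Suc n). ?w (Suc n, h) * q (Suc n, h) u) = 0" if u: "u \<in> T n" for u
  proof -
    have "(\<Sum>x\<in>T (Suc n). ?w x * q x u) = 0"
      using trunc_inv_q[OF jT, of u] u by (auto simp: in_T_iff)
    then show ?thesis by (simp add: sum_T)
  qed
  have inner: "(\<Sum>u\<in>T n. q (Suc n, h) u * trunc_inv n u y) = (\<Sum>i\<in>level M n. q (Suc n, h) (n, i) * trunc_inv n (n, i) y)"
    if h: "h \<in> level M (Suc n)" for h
  proof (rule sum_T_top)
    fix x assume "x \<in> T n" "fst x < n"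
    then show "q (Suc n, h) x * trunc_inv n x y = 0"
      using h Hessenberg_zero[of "(Suc n, h)" x] T_imp_S[of x n] by (auto simp: states_def)
  qed
  have "(\<Sum>u\<in>T n. (\<Sum>x\<in>T n. ?w x * q x u) * trunc_inv n u y) = (\<Sum>x\<in>T n. ?w x * (\<Sum>u\<in>T n. q x u * trunc_inv n u y))"
    unfolding sum_distrib_right sum_distrib_left by (subst sum.swap) (simp add: mult.assoc)
  also have "\<dots> = (\<Sum>x\<in>T n. if x = y then - ?w x else 0)"
    by (rule sum.cong) (use q_trunc_inv[OF _ y] in auto)
  also have "\<dots> = - ?w y" using y by simp
  finally have 1: "(\<Sum>u\<in>T n. (\<Sum>x\<in>T n. ?w x * q x u) * trunc_inv n u y) = - ?w y" .
  have "(\<Sum>u\<in>T n. (\<Sum>h\<in>level M (Suc n). ?w (Suc n, h) * q (Suc n, h) u) * trunc_inv n u y)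
      = (\<Sum>h\<in>level M (Suc n). ?w (Suc n, h) * (\<Sum>u\<in>T n. q (Suc n, h) u * trunc_inv n u y))"
    unfolding sum_distrib_right sum_distrib_left by (subst sum.swap) (simp add: mult.assoc)
  also have "\<dots> = (\<Sum>h\<in>level M (Suc n). ?w (Suc n, h) * (\<Sum>i\<in>level M n. q (Suc n, h) (n, i) * trunc_inv n (n, i) y))"
    by (simp add: inner)
  finally have 2: "(\<Sum>u\<in>T n. (\<Sum>h\<in>level M (Suc n). ?w (Suc n, h) * q (Suc n, h) u) * trunc_inv n u y) = \<dots>" .
  have "(\<Sum>u\<in>T n. ((\<Sum>x\<in>T n. ?w x * q x u) + (\<Sum>h\<in>level M (Suc n). ?w (Suc n, h) * q (Suc n, h) u)) * trunc_inv n u y) = 0"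
    using flow by simp
  then show ?thesis using 1 2 by (simp add: distrib_right sum.distrib)
qed

lemma X_trunc_eq: "X_trunc M q n k l i j = trunc_inv n (k, i) (l, j)"
  by (simp add: X_trunc_def block_of_def trunc_inv_def)

lemma U2_star_eq:
  assumes j: "j \<in> level M n" and i: "i \<in> level M k" and k: "k \<le> n"
  shows "U2_star M q n k j i = trunc_inv n (n, j) (k, i)"
proof (cases "k = n")
  case True
  then have "U2_star M q n k j i = (\<Sum>h\<in>level M n. if h = i then trunc_inv n (n, j) (n, h) else 0)"
    unfolding U2_star_def block_mult_def U2_def U_star_def X_trunc_eq id_block_def
    by (auto intro!: sum.cong)
  also have "\<dots> = trunc_inv n (n, j) (k, i)" using i True by (simp add: level_def)
  finally show ?thesis .
next
  case False
  then obtain m where m: "n = Suc m" "k \<le> m" using k by (cases n) auto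
  show ?thesis
    using trunc_inv_last_row[of j m "(k, i)"] j i m False level_in_T[OF i m(2)]
    by (simp add: U2_star_def block_mult_def U2_def U_star_def X_trunc_eq block_of_def)
qed

text \<open>
  Each further factor \<open>U\<^sub>n = Q\<^bsub>n+1,n\<^esub> U\<^sub>n\<^sup>*\<close> on the left turns \<open>U\<^bsub>n,k\<^esub>\<close> into
  \<open>Q\<^bsub>n+1,n\<^esub> U\<^sub>n\<^sup>* U\<^bsub>n,k\<^esub>\<close>, and \<open>U\<^sub>n\<^sup>* U\<^bsub>n,k\<^esub>\<close> is a block of the inverse by
  \<open>U2_star_eq\<close>; this is the definition of \<open>U\<^bsub>n+1,k\<^esub>\<close>.
\<close>
lemma U1_prod_eq:
  assumes "k \<le> n" "i \<in> level M k"
  shows "U1_prod M q n k j i = U2 M q n k j i"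
  using assms
proof (induction n arbitrary: j)
  case 0
  then show ?case by (simp add: U2_def)
next
  case (Suc n)
  show ?case
  proof (cases "k \<le> n")
    case True
    have "U1_prod M q (Suc n) k j i = (\<Sum>h\<in>level M n. (\<Sum>s\<in>level M n. q (Suc n, j) (n, s) * U_star M q n s h) * U2 M q n k h i)"
      using True Suc by (simp add: block_mult_def U1_def block_of_def)
    also have "\<dots> = (\<Sum>s\<in>level M n. q (Suc n, j) (n, s) * U2_star M q n k s i)"
      unfolding U2_star_def block_mult_def sum_distrib_right sum_distrib_left
      by (subst sum.swap) (simp add: mult.assoc)
    also have "\<dots> = (\<Sum>s\<in>level M n. q (Suc n, j) (n, s) * trunc_inv n (n, s) (k, i))"
      using True Suc.prems by (simp add: U2_star_eq)
    also have "\<dots> = U2 M q (Suc n) k j i"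
      using True by (simp add: U2_def block_mult_def block_of_def X_trunc_eq)
    finally show ?thesis .
  next
    case False
    then show ?thesis using Suc.prems by (simp add: U2_def)
  qed
qed

lemma U_star_U1_prod_eq:
  assumes "k \<le> n" "i \<in> level M k"
  shows "block_mult (level M n) (U_star M q n) (U1_prod M q n k) j i = U2_star M q n k j i"
  unfolding U2_star_def block_mult_def using U1_prod_eq[OF assms] by simp

lemma u_star_eq: "j \<in> level M n \<Longrightarrow> u_star M q n j = row_mass n (n, j)"
  by (simp add: u_star_def row_mass_def sum_T block_vec_def U2_star_eq)

lemma outside_v_eq:
  assumes "(k, i) \<in> S"
  shows "(\<Sum>\<^sub>\<infinity>l\<in>{n<..}. block_vec (level M l) (block_of q k l) (\<lambda>h. v (l, h)) i) = outside_v n (k, i)"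
proof -
  let ?f = "\<lambda>y. q (k, i) y * v y"
  have eq: "S - T n = Sigma {n<..} (level M)" by (auto simp: states_def states_upto_def)
  have "?f summable_on (Sigma {n<..} (level M))"
    unfolding eq[symmetric] by (rule summable_on_subset[OF v_summable[OF assms]]) auto
  from infsum_Sigma_banach[OF this]
  have "(\<Sum>\<^sub>\<infinity>l\<in>{n<..}. \<Sum>\<^sub>\<infinity>h\<in>level M l. ?f (l, h)) = outside_v n (k, i)"
    by (simp add: outside_v_def eq)
  then show ?thesis by (simp add: block_vec_def block_of_def level_def)
qed

lemma y_vec_eq: "j \<in> level M n \<Longrightarrow> y_vec M q v n j = row_cost n (n, j)"
  by (simp add: y_vec_def row_cost_def sum_T block_vec_def[of "level M _" "U2_star M q n _"] U2_star_eq outside_v_eq states_def)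

end

section \<open>Convergence of the optimally augmented truncations\<close>

lemma vec_block_unit_mass: "finite I \<Longrightarrow> j \<in> I \<Longrightarrow> vec_block I (unit_mass j) A i = A j i"
  by (simp add: vec_block_def unit_mass_def of_bool_def if_distrib[of "\<lambda>c. c * _"] cong: if_cong)

lemma inner_on_unit_mass: "finite I \<Longrightarrow> j \<in> I \<Longrightarrow> inner_on I (unit_mass j) u = u j"
  by (simp add: inner_on_def unit_mass_def of_bool_def if_distrib[of "\<lambda>c. c * _"] cong: if_cong)

theorem corollary3p1:
  fixes M :: "nat \<Rightarrow> nat"
    and q :: "state \<Rightarrow> state \<Rightarrow> real"
    and P :: "state \<Rightarrow> 'w measure"
    and X :: "real \<Rightarrow> 'w \<Rightarrow> state"
    and p v :: "state \<Rightarrow> real"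
    and jstar :: "nat \<Rightarrow> nat"
  assumes "\<And>k. 1 \<le> M k"
    and "conservative_generator (states M) q"
    and "regular_jump_Markov_chain (states M) q P X"
    and "ergodic_chain (states M) q P X"
    and "upper_block_Hessenberg M q"
    and "stationary_distribution (states M) q p"
    and "condition1 M q v"
    and "condition2 M q p v"
    and "\<And>n. is_arg_min (\<lambda>j. y_vec M q v n j / u_star M q n j) (\<lambda>j. j \<in> level M n) (jstar n)"
  shows "(\<forall>k. \<forall>i\<in>level M k.
           (\<lambda>n. vec_block (level M n) (unit_mass (jstar n)) (U2_star M q n k) i /
                inner_on (level M n) (unit_mass (jstar n)) (u_star M q n))
             \<longlonglongrightarrow> p (k, i)) \<and>
         (\<forall>k. \<forall>i\<in>level M k.
           (\<lambda>n. vec_block (level M n) (unit_mass (jstar n))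
                  (block_mult (level M n) (U_star M q n) (U1_prod M q n k)) i /
                inner_on (level M n) (unit_mass (jstar n))
                  (\<lambda>j. \<Sum>l\<le>n. block_vec (level M l)
                     (block_mult (level M n) (U_star M q n) (U1_prod M q n l)) (\<lambda>_. 1) j))
             \<longlonglongrightarrow> p (k, i))"
proof -
  interpret hessenberg_drift M q p v
    by unfold_locales (use assms in auto)
  have fin: "finite (level M n)" for n by (simp add: level_def)
  have j: "jstar n \<in> level M n" for n using assms(9)[of n] by (simp add: is_arg_min_def)
  have min: "row_cost n (n, jstar n) / row_mass n (n, jstar n) \<le> row_cost n (n, i) / row_mass n (n, i)"
    if "i \<in> level M n" for n i
    using assms(9)[of n] that j by (auto simp: is_arg_min_linorder y_vec_eq u_star_eq)
  have lim: "(\<lambda>n. trunc_inv n (n, jstar n) (k, i) / row_mass n (n, jstar n)) \<longlonglongrightarrow> p (k, i)"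
    if "i \<in> level M k" for k i
    by (rule truncated_row_tendsto[OF j min]) (use that in \<open>auto simp: states_def\<close>)
  have first: "(\<lambda>n. vec_block (level M n) (unit_mass (jstar n)) (U2_star M q n k) i /
      inner_on (level M n) (unit_mass (jstar n)) (u_star M q n)) \<longlonglongrightarrow> p (k, i)"
    if i: "i \<in> level M k" for k i
  proof (rule Lim_transform_eventually[OF lim[OF i]])
    show "\<forall>\<^sub>F n in sequentially. trunc_inv n (n, jstar n) (k, i) / row_mass n (n, jstar n) =
        vec_block (level M n) (unit_mass (jstar n)) (U2_star M q n k) i /
        inner_on (level M n) (unit_mass (jstar n)) (u_star M q n)"
      using eventually_ge_at_top[of k]
      by eventually_elim (simp add: vec_block_unit_mass inner_on_unit_mass fin j i U2_star_eq u_star_eq)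
  qed
  have denominator: "(\<Sum>l\<le>n. block_vec (level M l)
      (block_mult (level M n) (U_star M q n) (U1_prod M q n l)) (\<lambda>_. 1) j) = u_star M q n j" for n j
    by (simp add: u_star_def block_vec_def U_star_U1_prod_eq)
  have "(\<lambda>n. vec_block (level M n) (unit_mass (jstar n))
        (block_mult (level M n) (U_star M q n) (U1_prod M q n k)) i /
      inner_on (level M n) (unit_mass (jstar n)) (\<lambda>j. \<Sum>l\<le>n. block_vec (level M l)
        (block_mult (level M n) (U_star M q n) (U1_prod M q n l)) (\<lambda>_. 1) j)) \<longlonglongrightarrow> p (k, i)"
    if i: "i \<in> level M k" for k i
  proof (rule Lim_transform_eventually[OF first[OF i]])
    show "\<forall>\<^sub>F n in sequentially. vec_block (level M n) (unit_mass (jstar n)) (U2_star M q n k) i /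
        inner_on (level M n) (unit_mass (jstar n)) (u_star M q n) =
        vec_block (level M n) (unit_mass (jstar n))
          (block_mult (level M n) (U_star M q n) (U1_prod M q n k)) i /
        inner_on (level M n) (unit_mass (jstar n)) (\<lambda>j. \<Sum>l\<le>n. block_vec (level M l)
          (block_mult (level M n) (U_star M q n) (U1_prod M q n l)) (\<lambda>_. 1) j)"
      using eventually_ge_at_top[of k]
      by eventually_elim (simp add: denominator vec_block_def U_star_U1_prod_eq i)
  qed
  with first show ?thesis by blast
qed

end
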